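(* Assume $a>-2$ and $s,m\ge0$. If $$s+m+1<\min\Big(\frac{N+2}{N-2},\frac{N+2+2a}{N-2}\Big),$$ then the system $$-\Delta u=|x|^a u^s v^{m+1},\qquad -\Delta v=|x|^a u^{s+1}v^m$$ in $\mathbb R^N$ admits no (radial or nonradial) ground state (G.S.).
   Context: Standing assumptions: $N>2$ and $D=s+m>0$. A (possibly nonradial) ground state (G.S.) is a solution $(u,v)$ of the system in $\mathbb R^N\setminus\{0\}$ with $u,v>0$, defined globally and regular at $0$, i.e. $u,v\in C^2(\mathbb R^N\setminus\{0\})\cap C(\mathbb R^N)$. *)

theory Defs
  imports "HOL-Analysis.Analysis"
begin

definition partial_deriv :: "'a::euclidean_space \<Rightarrow> ('a \<Rightarrow> real) \<Rightarrow> 'a \<Rightarrow> real" where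
  "partial_deriv i f x = frechet_derivative f (at x) i"

text \<open>The derivatives are taken at full neighbourhoods, so these are the classes
  \<open>C\<^sup>1(S)\<close> and \<open>C\<^sup>2(S)\<close> for open \<open>S\<close>.\<close>

definition C1_on :: "'a::euclidean_space set \<Rightarrow> ('a \<Rightarrow> real) \<Rightarrow> bool" where
  "C1_on S f \<longleftrightarrow> (\<forall>x\<in>S. f differentiable (at x)) \<and>
    (\<forall>i\<in>Basis. continuous_on S (partial_deriv i f))"

definition C2_on :: "'a::euclidean_space set \<Rightarrow> ('a \<Rightarrow> real) \<Rightarrow> bool" where
  "C2_on S f \<longleftrightarrow> C1_on S f \<and> (\<forall>i\<in>Basis. C1_on S (partial_deriv i f))"

definition laplacian :: "('a::euclidean_space \<Rightarrow> real) \<Rightarrow> 'a \<Rightarrow> real" where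
  "laplacian f x = (\<Sum>i\<in>Basis. partial_deriv i (partial_deriv i f) x)"

text \<open>No symmetry is assumed, so both radial and nonradial ground states are covered.
  As the system is posed on \<open>- {0}\<close>, positivity is only required there.\<close>

definition ground_state ::
    "real \<Rightarrow> real \<Rightarrow> real \<Rightarrow> ('a::euclidean_space \<Rightarrow> real) \<Rightarrow> ('a \<Rightarrow> real) \<Rightarrow> bool" where
  "ground_state a s m u v \<longleftrightarrow>
    C2_on (- {0}) u \<and> C2_on (- {0}) v \<and>
    continuous_on UNIV u \<and> continuous_on UNIV v \<and>
    (\<forall>x. x \<noteq> 0 \<longrightarrow> u x > 0 \<and> v x > 0 \<and>
      - laplacian u x = norm x powr a * u x powr s * v x powr (m + 1) \<and>
      - laplacian v x = norm x powr a * u x powr (s + 1) * v x powr m)"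

end

theory Submission
  imports Defs
begin

text \<open>The proof moves spheres centred at the origin.  Let \<open>n\<close> be the dimension and \<open>p = s + m + 1\<close>, and write
  \<open>u\<^sub>l(x) = (l/|x|)\<^bsup>n-2\<^esup> u(l\<^sup>2 x/|x|\<^sup>2)\<close> for the Kelvin transform about the sphere of radius \<open>l\<close>.
  Outside that sphere the pair \<open>(u\<^sub>l, v\<^sub>l)\<close> solves the same system with the right-hand sides multiplied by
  \<open>(l/|x|)\<^bsup>n+2+2a-p(n-2)\<^esup>\<close>.  Subcriticality makes this factor smaller than \<open>1\<close>, so \<open>(u\<^sub>l, v\<^sub>l)\<close>
  is a strict subsolution there (\<open>kelvin_strict_subsolution\<close>).  The nonlinearity is nondecreasing in both
  unknowns; hence as long as \<open>u \<ge> u\<^sub>l\<close> and \<open>v \<ge> v\<^sub>l\<close> outside the sphere, the differences are strictly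
  superharmonic, and strictly positive off the sphere.

  This domination persists when \<open>l\<close> grows a little (\<open>domination_step\<close>).  Far from the sphere, a positive
  superharmonic function is bounded below by a multiple of \<open>|x|\<^bsup>2-n\<^esup>\<close>, which absorbs a small change of
  \<open>l\<close> uniformly up to infinity, since \<open>|x|\<^bsup>n-2\<^esup> u\<^sub>l(x)\<close> is uniformly continuous in \<open>l\<close>
  and the inverted point (\<open>far_step\<close>).  Near the sphere, a maximum principle on narrow annuli applies
  (\<open>near_step\<close>).  Both work for \<open>l = 0\<close>, where \<open>u\<^sub>0 = 0\<close>, so that \<open>l = 0\<close> starts
  the procedure, and every \<open>l \<ge> 0\<close> is reached.

  Domination for all \<open>l\<close> says that \<open>|x|\<^bsup>(n-2)/2\<^esup> u(x)\<close> is nondecreasing along rays, whence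
  \<open>u, v \<ge> c |x|\<^bsup>-(n-2)/2\<^esup>\<close> for \<open>|x| \<ge> 1\<close>.  Then \<open>z = min u v\<close> satisfies, where it equals \<open>u\<close>
  and correspondingly where it equals \<open>v\<close>, the inequality \<open>- \<Delta> z \<ge> V z\<close> with
  \<open>V = |x|\<^sup>a z\<^bsup>p-1\<^esup> \<ge> c' |x|\<^bsup>\<delta>-2\<^esup>\<close>, and \<open>\<delta> > 0\<close> is once more subcriticality.  On a ball of
  large radius \<open>R\<close> whose centre \<open>x\<^sub>0\<close> has norm \<open>2R\<close>, \<open>V\<close> exceeds every fixed multiple of \<open>R\<^bsup>-2\<^esup>\<close>.
  Touching \<open>z\<close> from below by a multiple of the bump \<open>(R\<^sup>2 - |x - x\<^sub>0|\<^sup>2)\<^sup>2\<close> then gives a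
  contradiction (\<open>no_bump_touching\<close>).

  Every comparison is a touching argument: a function with a local minimum has a nonnegative Laplacian
  there.  As the superharmonicity is strict, this takes the place of the strong maximum principle, and the
  narrow annuli take that of a boundary point lemma.\<close>

section \<open>A pointwise calculus for the Laplacian\<close>

text \<open>The relation records the gradient \<open>g\<close> and the Laplacian \<open>L\<close> of \<open>f\<close> at a single point, the latter as the
  trace of the derivative of the gradient field.  In this coordinate-free form the product and chain
  rules become statements about traces of linear maps.\<close>

definition has_lap :: "('a::euclidean_space \<Rightarrow> real) \<Rightarrow> 'a \<Rightarrow> 'a \<Rightarrow> real \<Rightarrow> bool" where
  "has_lap f x g L \<longleftrightarrow> (\<exists>G H. (\<forall>\<^sub>F y in nhds x. (f has_derivative (\<lambda>h. G y \<bullet> h)) (at y)) \<and>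
     (G has_derivative H) (at x) \<and> G x = g \<and> (\<Sum>i\<in>Basis. H i \<bullet> i) = L)"

lemma has_lapI:
  assumes "\<forall>\<^sub>F y in nhds x. (f has_derivative (\<lambda>h. G y \<bullet> h)) (at y)"
    "(G has_derivative H) (at x)" "G x = g" "(\<Sum>i\<in>Basis. H i \<bullet> i) = L"
  shows "has_lap f x g L"
  using assms unfolding has_lap_def by blast

lemma has_lapE:
  assumes "has_lap f x g L"
  obtains G H where "\<forall>\<^sub>F y in nhds x. (f has_derivative (\<lambda>h. G y \<bullet> h)) (at y)"
    "(f has_derivative (\<lambda>h. g \<bullet> h)) (at x)"
    "(G has_derivative H) (at x)" "G x = g" "(\<Sum>i\<in>Basis. H i \<bullet> i) = L"
proof -
  obtain G H where *: "\<forall>\<^sub>F y in nhds x. (f has_derivative (\<lambda>h. G y \<bullet> h)) (at y)"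
    "(G has_derivative H) (at x)" "G x = g" "(\<Sum>i\<in>Basis. H i \<bullet> i) = L"
    using assms unfolding has_lap_def by blast
  with eventually_nhds_x_imp_x[OF *(1)] show thesis by (intro that[OF *(1) _ *(2-4)]) auto
qed

lemma has_lap_const: "has_lap (\<lambda>_. c) x 0 0"
  by (rule has_lapI[where G="\<lambda>_. 0" and H="\<lambda>_. 0"]) (auto intro!: derivative_eq_intros)

lemma has_lap_mult:
  assumes "has_lap f1 x g1 L1" "has_lap f2 x g2 L2"
  shows "has_lap (\<lambda>y. f1 y * f2 y) x (f1 x *\<^sub>R g2 + f2 x *\<^sub>R g1)
           (f1 x * L2 + f2 x * L1 + 2 * (g1 \<bullet> g2))"
proof -
  obtain G1 H1 where 1: "\<forall>\<^sub>F y in nhds x. (f1 has_derivative (\<lambda>h. G1 y \<bullet> h)) (at y)"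
    "(f1 has_derivative (\<lambda>h. g1 \<bullet> h)) (at x)"
    "(G1 has_derivative H1) (at x)" "G1 x = g1" "(\<Sum>i\<in>Basis. H1 i \<bullet> i) = L1"
    using assms(1) by (rule has_lapE)
  obtain G2 H2 where 2: "\<forall>\<^sub>F y in nhds x. (f2 has_derivative (\<lambda>h. G2 y \<bullet> h)) (at y)"
    "(f2 has_derivative (\<lambda>h. g2 \<bullet> h)) (at x)"
    "(G2 has_derivative H2) (at x)" "G2 x = g2" "(\<Sum>i\<in>Basis. H2 i \<bullet> i) = L2"
    using assms(2) by (rule has_lapE)
  show ?thesis
  proof (rule has_lapI[where G="\<lambda>y. f1 y *\<^sub>R G2 y + f2 y *\<^sub>R G1 y" and
        H="\<lambda>h. (g1 \<bullet> h) *\<^sub>R g2 + f1 x *\<^sub>R H2 h + ((g2 \<bullet> h) *\<^sub>R g1 + f2 x *\<^sub>R H1 h)"])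
    show "\<forall>\<^sub>F y in nhds x. ((\<lambda>y. f1 y * f2 y) has_derivative
            (\<lambda>h. (f1 y *\<^sub>R G2 y + f2 y *\<^sub>R G1 y) \<bullet> h)) (at y)"
      using 1(1) 2(1)
      by eventually_elim (auto intro!: derivative_eq_intros simp: inner_add_left)
    show "((\<lambda>y. f1 y *\<^sub>R G2 y + f2 y *\<^sub>R G1 y) has_derivative
      (\<lambda>h. (g1 \<bullet> h) *\<^sub>R g2 + f1 x *\<^sub>R H2 h + ((g2 \<bullet> h) *\<^sub>R g1 + f2 x *\<^sub>R H1 h))) (at x)"
      using 1 2 by (auto intro!: derivative_eq_intros)
    show "(\<Sum>i\<in>Basis. ((g1 \<bullet> i) *\<^sub>R g2 + f1 x *\<^sub>R H2 i + ((g2 \<bullet> i) *\<^sub>R g1 + f2 x *\<^sub>R H1 i)) \<bullet> i) =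
       f1 x * L2 + f2 x * L1 + 2 * (g1 \<bullet> g2)"
      unfolding 1(5)[symmetric] 2(5)[symmetric] euclidean_inner[of g1 g2]
      by (simp add: inner_add_left sum.distrib sum_distrib_left algebra_simps)
  qed (use 1 2 in auto)
qed

lemma has_lap_add:
  assumes "has_lap f1 x g1 L1" "has_lap f2 x g2 L2"
  shows "has_lap (\<lambda>y. f1 y + f2 y) x (g1 + g2) (L1 + L2)"
proof -
  obtain G1 H1 where 1: "\<forall>\<^sub>F y in nhds x. (f1 has_derivative (\<lambda>h. G1 y \<bullet> h)) (at y)"
    "(f1 has_derivative (\<lambda>h. g1 \<bullet> h)) (at x)"
    "(G1 has_derivative H1) (at x)" "G1 x = g1" "(\<Sum>i\<in>Basis. H1 i \<bullet> i) = L1"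
    using assms(1) by (rule has_lapE)
  obtain G2 H2 where 2: "\<forall>\<^sub>F y in nhds x. (f2 has_derivative (\<lambda>h. G2 y \<bullet> h)) (at y)"
    "(f2 has_derivative (\<lambda>h. g2 \<bullet> h)) (at x)"
    "(G2 has_derivative H2) (at x)" "G2 x = g2" "(\<Sum>i\<in>Basis. H2 i \<bullet> i) = L2"
    using assms(2) by (rule has_lapE)
  show ?thesis
  proof (rule has_lapI[where G="\<lambda>y. G1 y + G2 y" and H="\<lambda>h. H1 h + H2 h"])
    show "\<forall>\<^sub>F y in nhds x. ((\<lambda>y. f1 y + f2 y) has_derivative (\<lambda>h. (G1 y + G2 y) \<bullet> h)) (at y)"
      using 1(1) 2(1)
      by eventually_elim (auto intro!: derivative_eq_intros simp: inner_add_left)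
    show "((\<lambda>y. G1 y + G2 y) has_derivative (\<lambda>h. H1 h + H2 h)) (at x)"
      using 1 2 by (auto intro!: derivative_eq_intros)
  qed (use 1 2 in \<open>auto simp: inner_add_left sum.distrib\<close>)
qed

lemma has_lap_cmult:
  assumes "has_lap f x g L"
  shows "has_lap (\<lambda>y. c * f y) x (c *\<^sub>R g) (c * L)"
  using has_lap_mult[OF has_lap_const[of c x] assms] by simp

lemma has_lap_diff:
  assumes "has_lap f1 x g1 L1" "has_lap f2 x g2 L2"
  shows "has_lap (\<lambda>y. f1 y - f2 y) x (g1 - g2) (L1 - L2)"
  using has_lap_add[OF assms(1) has_lap_cmult[OF assms(2), of "-1"]] by simp

lemma has_lap_norm_powr:
  fixes x :: "'a::euclidean_space"
  assumes "x \<noteq> 0"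
  shows "has_lap (\<lambda>y. norm y powr b) x ((b * norm x powr (b - 2)) *\<^sub>R x)
    (b * (b + DIM('a) - 2) * norm x powr (b - 2))"
proof -
  have deriv: "((\<lambda>y. norm y powr b) has_derivative (\<lambda>h. (b * norm y powr (b - 2)) *\<^sub>R y \<bullet> h)) (at y)"
    if "y \<noteq> 0" for y :: 'a and b :: real
  proof -
    have "norm y > 0" using that by simp
    then have e: "norm y powr b = norm y powr (b - 2) * norm y * norm y"
      by (simp add: powr_diff power2_eq_square)
    have "((\<lambda>y. norm y powr b) has_derivative
       (\<lambda>h. norm y powr b * (0 * ln (norm y) + (h \<bullet> sgn y) * b / norm y))) (at y)"
      by (rule derivative_eq_intros refl has_derivative_norm that | use that in simp)+
    moreover have "(\<lambda>h. norm y powr b * (0 * ln (norm y) + (h \<bullet> sgn y) * b / norm y)) =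
        (\<lambda>h. (b * norm y powr (b - 2)) *\<^sub>R y \<bullet> h)"
      using that unfolding e by (auto simp: sgn_div_norm inner_commute field_simps)
    ultimately show ?thesis by simp
  qed
  have "\<forall>\<^sub>F y in nhds x. y \<noteq> 0"
    using t1_space_nhds[OF assms] by simp
  then have ev: "\<forall>\<^sub>F y in nhds x. ((\<lambda>y. norm y powr b) has_derivative
      (\<lambda>h. (b * norm y powr (b - 2)) *\<^sub>R y \<bullet> h)) (at y)"
    by eventually_elim (rule deriv)
  show ?thesis
  proof (rule has_lapI[OF ev, where H="\<lambda>h. (b * ((b-2) * norm x powr (b - 2 - 2) * (x \<bullet> h))) *\<^sub>R x
        + (b * norm x powr (b - 2)) *\<^sub>R h"])
    show "((\<lambda>y. (b * norm y powr (b - 2)) *\<^sub>R y) has_derivative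
        (\<lambda>h. (b * ((b-2) * norm x powr (b - 2 - 2) * (x \<bullet> h))) *\<^sub>R x
        + (b * norm x powr (b - 2)) *\<^sub>R h)) (at x)"
      using has_derivative_scaleR[OF has_derivative_mult_right[OF deriv[OF assms, of "b - 2"], of b]
          has_derivative_ident]
      by (simp add: mult_ac add.commute)
    have "norm x > 0" using assms by simp
    then have e: "norm x powr (b - 2) = norm x powr (b - 2 - 2) * (x \<bullet> x)"
      by (simp add: dot_square_norm flip: powr_numeral powr_add)
    show "(\<Sum>i\<in>Basis. ((b * ((b-2) * norm x powr (b - 2 - 2) * (x \<bullet> i))) *\<^sub>R x
        + (b * norm x powr (b - 2)) *\<^sub>R i) \<bullet> i) = b * (b + DIM('a) - 2) * norm x powr (b - 2)"
      unfolding e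
      by (simp add: inner_add_left sum.distrib euclidean_inner[of x x] mult.assoc
          flip: sum_distrib_left) (simp add: algebra_simps)
  qed auto
qed

text \<open>Inversion is conformal: its derivative at \<open>x\<close> is \<open>c/|x|\<^sup>2\<close> times the reflection in the hyperplane
  orthogonal to \<open>x\<close>.  Conjugating by a reflection preserves the trace, which yields the factor
  \<open>(c/|x|\<^sup>2)\<^sup>2\<close>; the first order term comes from the Laplacian of the inversion itself and is what the
  weight of the Kelvin transform cancels.\<close>

lemma has_lap_inversion:
  fixes x :: "'a::euclidean_space" and c :: real
  assumes "x \<noteq> 0" and u: "has_lap u ((c / (x \<bullet> x)) *\<^sub>R x) g L"
  shows "\<exists>g'. g' \<bullet> x = - (c / (x \<bullet> x)) * (g \<bullet> x) \<and>
     has_lap (\<lambda>y. u ((c / (y \<bullet> y)) *\<^sub>R y)) x g'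
       ((c / (x \<bullet> x))\<^sup>2 * L - 2 * (real DIM('a) - 2) * c * (g \<bullet> x) / (x \<bullet> x)\<^sup>2)"
proof -
  define J :: "'a \<Rightarrow> 'a" where "J = (\<lambda>y. (c / (y \<bullet> y)) *\<^sub>R y)"
  define Q where "Q = x \<bullet> x"
  have Q: "Q \<noteq> 0" using assms by (simp add: Q_def)
  \<comment> \<open>The derivative of the inversion at \<open>y\<close>, a symmetric linear map.\<close>
  define D :: "'a \<Rightarrow> 'a \<Rightarrow> 'a"
    where "D = (\<lambda>y e. (c / (y \<bullet> y)) *\<^sub>R e - (2 * c * (y \<bullet> e) / (y \<bullet> y)\<^sup>2) *\<^sub>R y)"
  obtain G H where G: "\<forall>\<^sub>F y in nhds (J x). (u has_derivative (\<lambda>h. G y \<bullet> h)) (at y)"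
    "(u has_derivative (\<lambda>h. g \<bullet> h)) (at (J x))"
    "(G has_derivative H) (at (J x))" "G (J x) = g" "(\<Sum>i\<in>Basis. H i \<bullet> i) = L"
    using u unfolding J_def by (rule has_lapE)
  have linH: "linear H" using G(3) by (rule has_derivative_linear)
  have dJ: "(J has_derivative D y) (at y)" if "y \<noteq> 0" for y
    unfolding J_def D_def using that
    by (auto intro!: derivative_eq_intros simp: inner_commute power2_eq_square field_simps fun_eq_iff)
  have tJ: "filterlim J (nhds (J x)) (nhds x)"
    using has_derivative_continuous[OF dJ[OF assms(1)]]
    by (simp add: continuous_at tendsto_at_iff_tendsto_nhds)
  have ne: "\<forall>\<^sub>F y in nhds x. y \<noteq> 0" using t1_space_nhds[OF assms(1)] by simp
  \<comment> \<open>The chain rule gives the adjoint of \<open>D y\<close> applied to \<open>G (J y)\<close>, and \<open>D y\<close> is self-adjoint.\<close>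
  define G' where "G' = (\<lambda>y. (c / (y \<bullet> y)) *\<^sub>R G (J y) - (2 * c * (y \<bullet> G (J y)) / (y \<bullet> y)\<^sup>2) *\<^sub>R y)"
  have 1: "\<forall>\<^sub>F y in nhds x. ((\<lambda>y. u (J y)) has_derivative (\<lambda>h. G' y \<bullet> h)) (at y)"
    using ne eventually_compose_filterlim[OF G(1) tJ]
  proof eventually_elim
    case (elim y)
    have "((\<lambda>y. u (J y)) has_derivative (\<lambda>h. G (J y) \<bullet> D y h)) (at y)"
      using has_derivative_compose[OF dJ[OF elim(1)] elim(2)] .
    moreover have "(\<lambda>h. G (J y) \<bullet> D y h) = (\<lambda>h. G' y \<bullet> h)"
      unfolding D_def G'_def by (auto simp: algebra_simps inner_commute)
    ultimately show ?case by simp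
  qed
  define K where "K = (\<lambda>e. H (D x e))"
  have dGJ: "((\<lambda>y. G (J y)) has_derivative K) (at x)"
    unfolding K_def by (rule has_derivative_compose[OF dJ[OF assms(1)] G(3)])
  define H' where "H' = (\<lambda>e. (c / Q) *\<^sub>R K e - (2 * c * (x \<bullet> e) / Q\<^sup>2) *\<^sub>R g
     - ((2 * c * (x \<bullet> g) / Q\<^sup>2) *\<^sub>R e
     + (2 * c * (e \<bullet> g + x \<bullet> K e) / Q\<^sup>2 - 8 * c * (x \<bullet> g) * (x \<bullet> e) / Q ^ 3) *\<^sub>R x))"
  have 2: "(G' has_derivative H') (at x)"
  proof -
    have q: "((\<lambda>y. c / (y \<bullet> y)) has_derivative (\<lambda>e. - (2 * c * (x \<bullet> e) / Q\<^sup>2))) (at x)"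
      using Q unfolding Q_def
      by (auto intro!: derivative_eq_intros simp: inner_commute power2_eq_square field_simps fun_eq_iff)
    have r: "((\<lambda>y. 2 * c * (y \<bullet> G (J y)) / (y \<bullet> y)\<^sup>2) has_derivative
       (\<lambda>e. 2 * c * (e \<bullet> g + x \<bullet> K e) / Q\<^sup>2 - 8 * c * (x \<bullet> g) * (x \<bullet> e) / Q ^ 3)) (at x)"
      using Q unfolding Q_def
      by (auto intro!: derivative_eq_intros dGJ simp: G(4) inner_commute power2_eq_square power3_eq_cube field_simps fun_eq_iff)
    have "(G' has_derivative (\<lambda>e. ((c / (x \<bullet> x)) *\<^sub>R K e + (- (2 * c * (x \<bullet> e) / Q\<^sup>2)) *\<^sub>R G (J x)) -
        ((2 * c * (x \<bullet> G (J x)) / (x \<bullet> x)\<^sup>2) *\<^sub>R e + 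
        (2 * c * (e \<bullet> g + x \<bullet> K e) / Q\<^sup>2 - 8 * c * (x \<bullet> g) * (x \<bullet> e) / Q ^ 3) *\<^sub>R x))) (at x)"
      unfolding G'_def
      by (intro has_derivative_diff has_derivative_scaleR q r dGJ has_derivative_ident)
    then show ?thesis by (simp add: H'_def G(4) Q_def)
  qed
  have sumx: "(\<Sum>i\<in>Basis. (x \<bullet> i) * (y \<bullet> i)) = x \<bullet> y" for y
    by (simp add: euclidean_inner[of x y])
  have sumH: "(\<Sum>i\<in>Basis. (x \<bullet> i) * f i) = f x" if "linear f" for f :: "'a \<Rightarrow> real"
  proof -
    have "f x = f (\<Sum>i\<in>Basis. (x \<bullet> i) *\<^sub>R i)" by (simp add: euclidean_representation)
    also have "\<dots> = (\<Sum>i\<in>Basis. (x \<bullet> i) * f i)"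
      using that by (simp add: linear_sum linear_scale)
    finally show ?thesis by simp
  qed
  have linK: "linear K" using dGJ by (rule has_derivative_linear)
  have Kx: "x \<bullet> K x = - (c / Q) * (x \<bullet> H x)"
  proof -
    have "D x x = (- (c / Q)) *\<^sub>R x"
      using Q by (auto simp: D_def Q_def power2_eq_square field_simps simp flip: scaleR_diff_left)
    then show ?thesis unfolding K_def by (simp add: linear_scale[OF linH] linear_neg[OF linH])
  qed
  have trK: "(\<Sum>i\<in>Basis. K i \<bullet> i) = c / Q * L - 2 * c / Q\<^sup>2 * (x \<bullet> H x)"
  proof -
    have "K i \<bullet> i = c / Q * (H i \<bullet> i) - 2 * c / Q\<^sup>2 * ((x \<bullet> i) * (H x \<bullet> i))" for i
      unfolding K_def D_def Q_def
      by (simp add: linear_diff[OF linH] linear_scale[OF linH] inner_diff_left)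
    then show ?thesis
      by (simp only: sum_subtractf sum_distrib_left[symmetric] sumx G(5))
  qed
  have trxK: "(\<Sum>i\<in>Basis. (x \<bullet> i) * (x \<bullet> K i)) = - (c / Q) * (x \<bullet> H x)"
    using sumH[of "\<lambda>e. x \<bullet> K e"] linK unfolding Kx
    by (simp add: linear_iff inner_add_right)
  have 3: "(\<Sum>i\<in>Basis. H' i \<bullet> i) = (c / Q)\<^sup>2 * L - 2 * (real DIM('a) - 2) * c * (g \<bullet> x) / Q\<^sup>2"
  proof -
    have "H' i \<bullet> i = c / Q * (K i \<bullet> i) - 2 * c / Q\<^sup>2 * ((x \<bullet> i) * (g \<bullet> i))
        - 2 * c * (x \<bullet> g) / Q\<^sup>2 - 2 * c / Q\<^sup>2 * ((x \<bullet> i) * (g \<bullet> i)) - 2 * c / Q\<^sup>2 * ((x \<bullet> i) * (x \<bullet> K i))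
        + 8 * c * (x \<bullet> g) / Q ^ 3 * ((x \<bullet> i) * (x \<bullet> i))" if "i \<in> Basis" for i
      using that unfolding H'_def
      by (simp add: inner_diff_left inner_add_left inner_Basis algebra_simps add_divide_distrib inner_commute[of i g])
    then have "(\<Sum>i\<in>Basis. H' i \<bullet> i) = c / Q * (c / Q * L - 2 * c / Q\<^sup>2 * (x \<bullet> H x)) - 2 * c / Q\<^sup>2 * (x \<bullet> g)
        - DIM('a) * (2 * c * (x \<bullet> g) / Q\<^sup>2) - 2 * c / Q\<^sup>2 * (x \<bullet> g) - 2 * c / Q\<^sup>2 * (- (c / Q) * (x \<bullet> H x))
        + 8 * c * (x \<bullet> g) / Q ^ 3 * Q"
      by (simp only: sum.cong[OF refl] sum.distrib sum_subtractf sum_distrib_left[symmetric] sumx trK trxK sum_constant Q_def)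
    also have "\<dots> = (c / Q)\<^sup>2 * L - 2 * (real DIM('a) - 2) * c * (g \<bullet> x) / Q\<^sup>2"
      using Q by (simp add: field_simps power2_eq_square power3_eq_cube inner_commute)
    finally show ?thesis .
  qed
  have 4: "G' x \<bullet> x = - (c / Q) * (g \<bullet> x)"
    using Q unfolding G'_def G(4)
    by (simp add: Q_def inner_diff_left inner_commute[of x g] power2_eq_square field_simps)
  show ?thesis
    using has_lapI[OF 1 2 refl 3] 4 unfolding J_def Q_def by blast
qed

lemma C2_on_has_lap:
  assumes "C2_on S f" "open S" "x \<in> S"
  shows "\<exists>g. has_lap f x g (laplacian f x)"
proof -
  define G where "G = (\<lambda>y. \<Sum>i\<in>Basis. partial_deriv i f y *\<^sub>R i)"
  define H where "H = (\<lambda>h. \<Sum>i\<in>Basis. frechet_derivative (partial_deriv i f) (at x) h *\<^sub>R i)"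
  have f: "f differentiable (at y)" if "y \<in> S" for y
    using assms that by (auto simp: C2_on_def C1_on_def)
  have p: "partial_deriv i f differentiable (at x)" if "i \<in> Basis" for i
    using assms that by (auto simp: C2_on_def C1_on_def)
  have "(f has_derivative (\<lambda>h. G y \<bullet> h)) (at y)" if "y \<in> S" for y
  proof -
    have d: "(f has_derivative frechet_derivative f (at y)) (at y)"
      using f[OF that] by (simp add: frechet_derivative_works)
    then have l: "linear (frechet_derivative f (at y))" by (rule has_derivative_linear)
    have "frechet_derivative f (at y) h = G y \<bullet> h" for h
    proof -
      have "frechet_derivative f (at y) h = frechet_derivative f (at y) (\<Sum>i\<in>Basis. (h \<bullet> i) *\<^sub>R i)"
        by (simp add: euclidean_representation)
      then show ?thesis
        by (simp add: linear_sum[OF l] linear_scale[OF l] G_def partial_deriv_def inner_sum_left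
            inner_commute[of h] mult.commute)
    qed
    then have "frechet_derivative f (at y) = (\<lambda>h. G y \<bullet> h)" by auto
    then show ?thesis using d by simp
  qed
  then have "\<forall>\<^sub>F y in nhds x. (f has_derivative (\<lambda>h. G y \<bullet> h)) (at y)"
    using assms by (auto simp: eventually_nhds)
  moreover have "(G has_derivative H) (at x)"
    unfolding G_def H_def using p
    by (intro has_derivative_sum has_derivative_scaleR_left) (simp add: frechet_derivative_works)
  moreover have "(\<Sum>i\<in>Basis. H i \<bullet> i) = laplacian f x"
    unfolding laplacian_def
  proof (rule sum.cong[OF refl])
    fix i :: 'a assume i: "i \<in> Basis"
    have "H i \<bullet> i = (\<Sum>j\<in>Basis. frechet_derivative (partial_deriv j f) (at x) i * (j \<bullet> i))"
      by (simp add: H_def inner_sum_left)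
    also have "\<dots> = partial_deriv i (partial_deriv i f) x"
      using i by (simp add: inner_Basis partial_deriv_def if_distrib cong: if_cong)
    finally show "H i \<bullet> i = partial_deriv i (partial_deriv i f) x" .
  qed
  ultimately show ?thesis using has_lapI by blast
qed

text \<open>If a second derivative at the minimum were negative along a coordinate line, the first derivative, which
  vanishes there, would become negative, and the function would decrease along that line.\<close>

lemma has_lap_local_min_nonneg:
  assumes f: "has_lap f x g L" and min: "\<forall>\<^sub>F y in nhds x. f x \<le> f y"
  shows "L \<ge> 0"
proof -
  obtain G H where G: "\<forall>\<^sub>F y in nhds x. (f has_derivative (\<lambda>h. G y \<bullet> h)) (at y)"
    "(f has_derivative (\<lambda>h. g \<bullet> h)) (at x)"
    "(G has_derivative H) (at x)" "G x = g" "(\<Sum>i\<in>Basis. H i \<bullet> i) = L"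
    using f by (rule has_lapE)
  have linH: "linear H" using G(3) by (rule has_derivative_linear)
  obtain r where r: "r > 0" "\<And>y. dist y x < r \<Longrightarrow> (f has_derivative (\<lambda>h. G y \<bullet> h)) (at y)"
    "\<And>y. dist y x < r \<Longrightarrow> f x \<le> f y"
    using eventually_conj[OF G(1) min] unfolding eventually_nhds_metric by blast
  have "H i \<bullet> i \<ge> 0" if i: "i \<in> Basis" for i
  proof (rule ccontr)
    assume neg: "\<not> H i \<bullet> i \<ge> 0"
    define F where "F = (\<lambda>t. f (x + t *\<^sub>R i))"
    define F' where "F' = (\<lambda>t. G (x + t *\<^sub>R i) \<bullet> i)"
    have line: "((\<lambda>t. x + t *\<^sub>R i) has_derivative (\<lambda>t. t *\<^sub>R i)) (at t)" for t :: real
      by (auto intro!: derivative_eq_intros)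
    have dF: "(F has_real_derivative F' t) (at t)" if "\<bar>t\<bar> < r" for t
    proof -
      have "(f has_derivative (\<lambda>h. G (x + t *\<^sub>R i) \<bullet> h)) (at (x + t *\<^sub>R i))"
        using r(2) that i by (simp add: dist_norm)
      from has_derivative_compose[OF line this]
      show ?thesis unfolding F_def F'_def has_field_derivative_def
        by (simp add: mult.commute[of _ "_ \<bullet> _"])
    qed
    have dF': "(F' has_real_derivative H i \<bullet> i) (at 0)"
    proof -
      have "((\<lambda>t. G (x + t *\<^sub>R i)) has_derivative (\<lambda>t. H (t *\<^sub>R i))) (at 0)"
        using has_derivative_compose[OF line[of 0], of G H] G(3) by simp
      from has_derivative_inner_left[OF this, of i]
      show ?thesis unfolding F'_def has_field_derivative_def
        by (simp add: linear_scale[OF linH] mult.commute[of _ "_ \<bullet> _"])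
    qed
    have F0: "F' 0 = 0"
    proof (rule DERIV_local_min[OF dF, of 0 r])
      show "\<forall>y. \<bar>0 - y\<bar> < r \<longrightarrow> F 0 \<le> F y"
        using r(3) i by (auto simp: F_def dist_norm)
    qed (use r in auto)
    obtain d where d: "d > 0" "\<And>h. 0 < h \<Longrightarrow> h < d \<Longrightarrow> F' h < 0"
      using DERIV_neg_dec_right[OF dF'] neg F0 by auto
    define t where "t = min r d / 2"
    have t: "0 < t" "t < r" "t < d" using d(1) r(1) by (auto simp: t_def)
    obtain z where z: "0 < z" "z < t" "F t - F 0 = (t - 0) * F' z"
      using MVT2[OF t(1), of F F'] dF t by auto
    then have "F t < F 0" using d(2)[of z] t
      by (smt (verit) mult_pos_neg)
    moreover have "F 0 \<le> F t" using r(3)[of "x + t *\<^sub>R i"] t i by (simp add: F_def dist_norm)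
    ultimately show False by simp
  qed
  then show ?thesis unfolding G(5)[symmetric] by (intro sum_nonneg)
qed

section \<open>Comparison for superharmonic functions\<close>

lemma has_lap_interior_min_nonneg:
  assumes "has_lap f x g L" "x \<in> interior S" "\<And>y. y \<in> S \<Longrightarrow> f x \<le> f y"
  shows "L \<ge> 0"
proof (rule has_lap_local_min_nonneg[OF assms(1)])
  have "\<forall>\<^sub>F y in nhds x. y \<in> interior S"
    using assms(2) by (intro eventually_nhds_in_open) auto
  then show "\<forall>\<^sub>F y in nhds x. f x \<le> f y"
    by eventually_elim (use assms(3) interior_subset in blast)
qed

lemma has_lap_continuous: "has_lap f x g L \<Longrightarrow> isCont f x"
  by (auto elim!: has_lapE intro: has_derivative_continuous)

definition annulus :: "real \<Rightarrow> real \<Rightarrow> 'a::real_normed_vector set" where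
  "annulus r R = {x. r \<le> norm x \<and> norm x \<le> R}"

lemma compact_annulus: "compact (annulus r R :: 'a::euclidean_space set)"
proof -
  have "annulus r R = cball (0::'a) R \<inter> {x. r \<le> norm x}" by (auto simp: annulus_def)
  then show ?thesis
    by (auto intro!: compact_Int_closed closed_Collect_le continuous_intros)
qed

lemma interior_annulus: "r < norm x \<Longrightarrow> norm x < R \<Longrightarrow> x \<in> interior (annulus r R)"
  for x :: "'a::euclidean_space"
  by (rule interiorI[where T="{x. r < norm x} \<inter> {x. norm x < R}"])
    (auto simp: annulus_def intro!: open_Collect_less continuous_intros)

lemma sphere_nonempty: "R > 0 \<Longrightarrow> \<exists>x::'a::euclidean_space. norm x = R"
  by (rule exI[of _ "R *\<^sub>R (SOME i. i \<in> Basis)"]) (simp add: norm_Basis some_in_eq)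

lemma fundamental_has_lap:
  fixes x :: "'a::euclidean_space"
  assumes "x \<noteq> 0"
  shows "\<exists>g. has_lap (\<lambda>y. norm y powr (2 - real DIM('a))) x g 0"
  using has_lap_norm_powr[OF assms, of "2 - real DIM('a)"] by auto

text \<open>The multiple of the fundamental solution is chosen below \<open>f\<close> on the sphere of radius \<open>R\<close>.  It tends to
  zero at infinity while \<open>f\<close> is positive, so a negative infimum of the difference would be attained at
  an interior point, where the Laplacian of the difference is negative.\<close>

lemma superharmonic_exterior_lower_bound:
  fixes f :: "'a::euclidean_space \<Rightarrow> real"
  assumes dim: "DIM('a) > 2" and R: "R > 0"
    and cont: "continuous_on {x. R \<le> norm x} f"
    and pos: "\<And>x. R \<le> norm x \<Longrightarrow> f x > 0"
    and super: "\<And>x. R < norm x \<Longrightarrow> \<exists>g L. has_lap f x g L \<and> L < 0"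
  shows "\<exists>c>0. \<forall>x. R \<le> norm x \<longrightarrow> c * norm x powr (2 - real DIM('a)) \<le> f x"
proof -
  define b where "b = 2 - real DIM('a)"
  have b: "b < 0" using dim by (simp add: b_def)
  have "\<exists>z\<in>sphere 0 R. \<forall>y\<in>sphere 0 R. f z \<le> f y"
    using sphere_nonempty[OF R, where 'a='a]
    by (intro continuous_attains_inf continuous_on_subset[OF cont]) auto
  then obtain z where z: "norm z = R" "\<And>y. norm y = R \<Longrightarrow> f z \<le> f y" by auto
  define c where "c = f z * R powr - b"
  have c: "c > 0" using pos[of z] z R by (simp add: c_def)
  define W where "W = (\<lambda>x. f x - c * norm x powr b)"
  have "W x \<ge> 0" if x: "R \<le> norm x" for x
  proof (rule ccontr)
    assume neg: "\<not> W x \<ge> 0"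
    have "((\<lambda>t. c * t powr b) \<longlongrightarrow> c * 0) at_top"
      using b by (intro tendsto_intros tendsto_neg_powr filterlim_ident)
    then have "\<forall>\<^sub>F t in at_top. c * t powr b < - W x"
      using neg by (intro order_tendstoD) auto
    from eventually_happens'[OF _ eventually_conj[OF this eventually_gt_at_top[of "norm x"]]]
    obtain R' where R': "c * R' powr b < - W x" "norm x < R'" by auto
    have "\<exists>y\<in>annulus R R'. \<forall>y'\<in>annulus R R'. W y \<le> W y'"
    proof (rule continuous_attains_inf[OF compact_annulus])
      show "annulus R R' \<noteq> ({} :: 'a set)" using x R' by (auto simp: annulus_def)
      show "continuous_on (annulus R R') W" unfolding W_def
        using R by (intro continuous_intros continuous_on_subset[OF cont]) (auto simp: annulus_def)
    qed
    then obtain y where y: "R \<le> norm y" "norm y \<le> R'" "\<And>y'. y' \<in> annulus R R' \<Longrightarrow> W y \<le> W y'"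
      by (auto simp: annulus_def)
    have le: "W y \<le> W x" using y(3)[of x] x R' by (simp add: annulus_def)
    have "norm y \<noteq> R"
    proof
      assume *: "norm y = R"
      have "W y \<ge> 0" using z(2)[OF *] R unfolding W_def * c_def by (simp add: powr_minus field_simps)
      then show False using le neg by simp
    qed
    moreover have "norm y \<noteq> R'"
    proof
      assume *: "norm y = R'"
      have "W y > W x" using pos[OF y(1)] R'(1) unfolding W_def[THEN fun_cong, of y] * by simp
      then show False using le by simp
    qed
    ultimately have y': "R < norm y" "norm y < R'" using y by auto
    obtain g L where L: "has_lap f y g L" "L < 0" using super[OF y'(1)] by blast
    obtain g' where "has_lap (\<lambda>y. norm y powr b) y g' 0"
      using fundamental_has_lap[of y] y'(1) R unfolding b_def by force
    from has_lap_diff[OF L(1) has_lap_cmult[OF this, of c]]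
    have "has_lap W y (g - c *\<^sub>R g') L" unfolding W_def by simp
    from has_lap_interior_min_nonneg[OF this interior_annulus[OF y'] y(3)] L(2) show False by simp
  qed
  with c show ?thesis unfolding W_def b_def by (intro exI[of _ c]) auto
qed

text \<open>The origin is a removable point: adding \<open>e |x|\<^bsup>2-n\<^esup>\<close> keeps the minimum away from it, and \<open>e\<close> tends to
  zero afterwards.  For a ground state this excludes the value \<open>0\<close> at the origin, where positivity is not
  assumed.\<close>

lemma superharmonic_punctured_lower_bound:
  fixes f :: "'a::euclidean_space \<Rightarrow> real"
  assumes dim: "DIM('a) > 2" and R: "R > 0"
    and pos: "\<And>x. x \<noteq> 0 \<Longrightarrow> f x > 0"
    and super: "\<And>x. x \<noteq> 0 \<Longrightarrow> \<exists>g L. has_lap f x g L \<and> L < 0"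
  shows "\<exists>c>0. \<forall>x. x \<noteq> 0 \<longrightarrow> norm x \<le> R \<longrightarrow> c \<le> f x"
proof -
  define b where "b = 2 - real DIM('a)"
  have b: "b < 0" using dim by (simp add: b_def)
  have cont: "continuous_on (- {0}) f"
    using super has_lap_continuous by (intro continuous_at_imp_continuous_on) blast
  have "\<exists>z\<in>sphere 0 R. \<forall>y\<in>sphere 0 R. f z \<le> f y"
    using sphere_nonempty[OF R, where 'a='a] R
    by (intro continuous_attains_inf continuous_on_subset[OF cont]) auto
  then obtain z where z: "norm z = R" "\<And>y. norm y = R \<Longrightarrow> f z \<le> f y" by auto
  define c where "c = f z"
  have c: "c > 0" using pos[of z] z R unfolding c_def by force
  have *: "c \<le> f x + e * norm x powr b" if x: "x \<noteq> 0" "norm x \<le> R" and e: "e > 0" for e x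
  proof (rule ccontr)
    define W where "W = (\<lambda>x. f x + e * norm x powr b)"
    assume "\<not> c \<le> f x + e * norm x powr b"
    then have neg: "W x < c" by (simp add: W_def)
    \<comment> \<open>The inner radius is so small that the singular term alone exceeds \<open>c\<close> there.\<close>
    define r where "r = min (norm x / 2) ((c / e + 1) powr (1 / b))"
    have ce: "c / e > 0" using c e by simp
    have r: "c / e < r powr b" "r < norm x" "0 < r"
    proof -
      show r0: "0 < r" using x ce by (auto simp: r_def)
      have "((c / e + 1) powr (1 / b)) powr b \<le> r powr b"
        using b r0 by (intro powr_mono2') (auto simp: r_def)
      then show "c / e < r powr b" using b ce by (simp add: powr_powr)
      have "r \<le> norm x / 2" unfolding r_def by (rule min.cobounded1)
      moreover have "norm x > 0" using x by simp
      ultimately show "r < norm x" by linarith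
    qed
    have "\<exists>y\<in>annulus r R. \<forall>y'\<in>annulus r R. W y \<le> W y'"
    proof (rule continuous_attains_inf[OF compact_annulus])
      show "annulus r R \<noteq> ({} :: 'a set)" using x r by (auto simp: annulus_def intro!: exI[of _ x])
      show "continuous_on (annulus r R) W" unfolding W_def
        using r by (intro continuous_intros continuous_on_subset[OF cont]) (auto simp: annulus_def)
    qed
    then obtain y where y: "r \<le> norm y" "norm y \<le> R" "\<And>y'. y' \<in> annulus r R \<Longrightarrow> W y \<le> W y'"
      by (auto simp: annulus_def)
    have y0: "y \<noteq> 0" using y r by auto
    have le: "W y < c" using y(3)[of x] x r neg by (simp add: annulus_def)
    have "norm y \<noteq> R"
    proof
      assume *: "norm y = R"
      have "W y \<ge> f y" using e by (simp add: W_def)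
      with z(2)[OF *] le show False by (simp add: c_def)
    qed
    moreover have "norm y \<noteq> r"
    proof
      assume *: "norm y = r"
      have "W y > c" using pos[OF y0] r(1) e unfolding W_def * by (simp add: field_simps)
      then show False using le by simp
    qed
    ultimately have y': "r < norm y" "norm y < R" using y by auto
    obtain g L where L: "has_lap f y g L" "L < 0" using super[OF y0] by blast
    obtain g' where "has_lap (\<lambda>y. norm y powr b) y g' 0"
      using fundamental_has_lap[OF y0] unfolding b_def by force
    from has_lap_add[OF L(1) has_lap_cmult[OF this, of e]]
    have "has_lap W y (g + e *\<^sub>R g') L" unfolding W_def by simp
    from has_lap_interior_min_nonneg[OF this interior_annulus[OF y'] y(3)] L(2) show False by simp
  qed
  have "c \<le> f x" if x: "x \<noteq> 0" "norm x \<le> R" for x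
  proof (rule field_le_epsilon)
    fix e :: real assume "e > 0"
    then show "c \<le> f x + e" using *[OF x, of "e / norm x powr b"] x by simp
  qed
  with c show ?thesis by blast
qed

section \<open>The Kelvin transform\<close>

text \<open>The value \<open>kelvin 0 u = 0\<close>, due to \<open>0 powr r = 0\<close>, is also the limit for \<open>l \<rightarrow> 0\<close> if \<open>n > 2\<close>.
  The degenerate sphere \<open>l = 0\<close> thus starts the continuation in \<open>l\<close>.\<close>

definition kelvin :: "real \<Rightarrow> ('a::euclidean_space \<Rightarrow> real) \<Rightarrow> 'a \<Rightarrow> real" where
  "kelvin l u x = l powr (real DIM('a) - 2) * norm x powr (2 - real DIM('a)) * u ((l\<^sup>2 / (x \<bullet> x)) *\<^sub>R x)"

lemma kelvin_has_lap:
  fixes x :: "'a::euclidean_space"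
  assumes x: "x \<noteq> 0" and u: "has_lap u ((l\<^sup>2 / (x \<bullet> x)) *\<^sub>R x) g L"
  shows "\<exists>g'. has_lap (kelvin l u) x g'
     (l powr (real DIM('a) - 2) * norm x powr (2 - real DIM('a)) * ((l\<^sup>2 / (x \<bullet> x))\<^sup>2 * L))"
proof -
  define n where "n = real DIM('a)"
  obtain g' where g': "g' \<bullet> x = - (l\<^sup>2 / (x \<bullet> x)) * (g \<bullet> x)"
    "has_lap (\<lambda>y. u ((l\<^sup>2 / (y \<bullet> y)) *\<^sub>R y)) x g'
       ((l\<^sup>2 / (x \<bullet> x))\<^sup>2 * L - 2 * (n - 2) * l\<^sup>2 * (g \<bullet> x) / (x \<bullet> x)\<^sup>2)"
    using has_lap_inversion[OF assms] unfolding n_def by blast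
  have h: "has_lap (\<lambda>y. norm y powr (2 - n)) x (((2 - n) * norm x powr (2 - n - 2)) *\<^sub>R x) 0"
    using has_lap_norm_powr[OF x, of "2 - n"] by (simp add: n_def)
  have Q: "x \<bullet> x \<noteq> 0" using x by simp
  have e: "norm x powr (2 - n - 2) = norm x powr (2 - n) / (x \<bullet> x)"
    using x by (simp add: powr_diff dot_square_norm powr_minus divide_inverse)
  have "norm x powr (2 - n) * ((l\<^sup>2 / (x \<bullet> x))\<^sup>2 * L - 2 * (n - 2) * l\<^sup>2 * (g \<bullet> x) / (x \<bullet> x)\<^sup>2) +
      u ((l\<^sup>2 / (x \<bullet> x)) *\<^sub>R x) * 0 + 2 * (((2 - n) * norm x powr (2 - n - 2)) *\<^sub>R x \<bullet> g')
     = norm x powr (2 - n) * ((l\<^sup>2 / (x \<bullet> x))\<^sup>2 * L)"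
    using Q unfolding e inner_scaleR_left inner_commute[of x g'] g'(1)
    by (simp add: field_simps power2_eq_square)
  from has_lap_cmult[OF has_lap_mult[OF h g'(2), unfolded this], of "l powr (n - 2)"]
  show ?thesis unfolding kelvin_def n_def mult.assoc by blast
qed

lemma continuous_on_kelvin:
  assumes "continuous_on UNIV u"
  shows "continuous_on (- {0}) (kelvin l u)"
  unfolding kelvin_def
  by (intro continuous_intros continuous_on_compose2[OF assms]) auto

text \<open>Up to the factor \<open>|x|\<^bsup>2-n\<^esup>\<close>, the exterior of a ball becomes a bounded set of inverted points, which
  makes compactness available up to infinity.\<close>

lemma kelvin_eq_inverted:
  fixes x :: "'a::euclidean_space"
  shows "kelvin l u x = norm x powr (2 - real DIM('a)) *
    (l powr (real DIM('a) - 2) * u (l\<^sup>2 *\<^sub>R (x /\<^sub>R (x \<bullet> x))))"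
  by (simp add: kelvin_def divide_inverse)

lemma norm_inversion: "norm ((l\<^sup>2 / (x \<bullet> x)) *\<^sub>R x) = l\<^sup>2 / norm x"
  by (cases "x = 0") (simp_all add: dot_square_norm power2_eq_square)

lemma kelvin_fixed: "0 < l \<Longrightarrow> norm x = l \<Longrightarrow> kelvin l u x = u x"
  by (simp add: kelvin_def dot_square_norm flip: powr_add mult.assoc)

lemma kelvin_le:
  fixes x :: "'a::euclidean_space"
  assumes dim: "DIM('a) > 2" and "0 < l" "l \<le> norm x" "\<And>y. norm y \<le> l \<Longrightarrow> u y \<le> M" "0 \<le> M"
  shows "kelvin l u x \<le> M"
proof -
  have x: "norm x > 0" using assms by linarith
  have 1: "l powr (real DIM('a) - 2) * norm x powr (2 - real DIM('a)) = (l / norm x) powr (real DIM('a) - 2)"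
    using assms(2) x by (simp add: powr_divide powr_diff field_simps)
  have "norm ((l\<^sup>2 / (x \<bullet> x)) *\<^sub>R x) \<le> l"
    unfolding norm_inversion using assms x by (simp add: field_simps power2_eq_square)
  then have 2: "u ((l\<^sup>2 / (x \<bullet> x)) *\<^sub>R x) \<le> M" using assms by blast
  have "(l / norm x) powr (real DIM('a) - 2) \<le> 1"
    using assms x by (intro powr_le1) (auto simp: field_simps)
  then have "(l / norm x) powr (real DIM('a) - 2) * u ((l\<^sup>2 / (x \<bullet> x)) *\<^sub>R x) \<le> 1 * M"
    by (intro order_trans[OF mult_left_mono[OF 2] mult_right_mono]) (use assms(5) in auto)
  then show ?thesis unfolding kelvin_def 1 by simp
qed

definition dominates_kelvin :: "real \<Rightarrow> ('a::euclidean_space \<Rightarrow> real) \<Rightarrow> bool" where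
  "dominates_kelvin l u \<longleftrightarrow> (\<forall>x. x \<noteq> 0 \<longrightarrow> l \<le> norm x \<longrightarrow> kelvin l u x \<le> u x)"

section \<open>The homogeneous nonlinearity\<close>

text \<open>One-sided Lipschitz bound that requires a positive lower bound only on \<open>x\<close> and \<open>y\<close>, as the Kelvin transforms
  \<open>x'\<close> and \<open>y'\<close> may be arbitrarily small and \<open>t powr s\<close> need not be Lipschitz at \<open>0\<close>.  Scaling \<open>x'\<close> and \<open>y'\<close>
  by \<open>k = c/(c + d)\<close> brings them below \<open>x\<close> and \<open>y\<close>; by homogeneity the product loses the factor
  \<open>k powr (s + m + 1)\<close>, which is at least \<open>1 - (s + m + 1)(1 - k)\<close>.\<close>

lemma homogeneous_lipschitz:
  fixes c M d s m x y x' y' :: real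
  assumes "0 < c" "0 \<le> d" "c \<le> x" "c \<le> y" "0 \<le> x'" "x' \<le> M" "0 \<le> y'" "y' \<le> M"
    "x' \<le> x + d" "y' \<le> y + d" "0 \<le> s" "0 \<le> m"
  shows "x' powr s * y' powr (m + 1) - x powr s * y powr (m + 1)
     \<le> (s + m + 1) * M powr (s + m + 1) / c * d"
proof -
  define p where "p = s + m + 1"
  define k where "k = c / (c + d)"
  have k: "0 < k" "k \<le> 1" using assms by (auto simp: k_def)
  have le: "k * t' \<le> t" if "c \<le> t" "t' \<le> t + d" for t t'
  proof -
    have "c * t' \<le> c * t + c * d" using mult_left_mono[OF that(2), of c] assms(1) by (simp add: algebra_simps)
    also have "\<dots> \<le> c * t + t * d" using that(1) assms(2) by (simp add: mult_right_mono)
    finally show ?thesis using assms(1,2) unfolding k_def by (simp add: field_simps)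
  qed
  have "k powr p * (x' powr s * y' powr (m + 1)) = (k * x') powr s * (k * y') powr (m + 1)"
    using k assms by (simp add: p_def powr_mult powr_add)
  also have "\<dots> \<le> x powr s * y powr (m + 1)"
    using le[of x x'] le[of y y'] k assms by (intro mult_mono powr_mono2) auto
  finally have 1: "x' powr s * y' powr (m + 1) - x powr s * y powr (m + 1)
      \<le> (1 - k powr p) * (x' powr s * y' powr (m + 1))" by (simp add: algebra_simps)
  have 2: "x' powr s * y' powr (m + 1) \<le> M powr p"
  proof -
    have "x' powr s * y' powr (m + 1) \<le> M powr s * M powr (m + 1)"
      using assms by (intro mult_mono powr_mono2) auto
    then show ?thesis by (simp add: p_def add.assoc flip: powr_add)
  qed
  have "1 - k powr p \<le> p * (1 - k)"
  proof (cases "k = 1")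
    case False
    then have "\<exists>z. k < z \<and> z < 1 \<and> 1 powr p - k powr p = (1 - k) * (p * z powr (p - 1))"
      using k by (intro MVT2) (auto intro!: has_real_derivative_powr)
    then obtain z where z: "k < z" "z < 1" "1 - k powr p = (1 - k) * (p * z powr (p - 1))" by auto
    have "z powr (p - 1) \<le> 1" using z k assms by (intro powr_le1) (auto simp: p_def)
    then have "p * z powr (p - 1) \<le> p" using assms by (simp add: p_def mult_left_le)
    then show ?thesis using z k by (simp add: mult.commute mult_left_mono)
  qed auto
  also have "1 - k \<le> d / c" using assms by (simp add: k_def field_simps)
  then have "p * (1 - k) \<le> p * (d / c)" using assms by (intro mult_left_mono) (auto simp: p_def)
  finally have 3: "1 - k powr p \<le> p * (d / c)" .
  have "k powr p \<le> 1" using k assms by (intro powr_le1) (auto simp: p_def)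
  then have "(1 - k powr p) * (x' powr s * y' powr (m + 1)) \<le> p * (d / c) * M powr p"
    using 2 3 by (intro mult_mono) auto
  with 1 show ?thesis by (simp add: p_def field_simps)
qed

section \<open>Moving spheres\<close>

locale subcritical_ground_state =
  fixes u v :: "'a::euclidean_space \<Rightarrow> real" and a s m :: real
  assumes dim: "DIM('a) > 2"
    and ground_state: "ground_state a s m u v"
    and exponents: "a > -2" "s \<ge> 0" "m \<ge> 0"
    and subcritical: "(s + m + 1) * (real DIM('a) - 2) < real DIM('a) + 2 + 2 * a"
begin

text \<open>Exchanging \<open>(u, s)\<close> and \<open>(v, m)\<close> preserves the system, so each fact about \<open>u\<close> holds for \<open>v\<close>.\<close>

lemma swap: "subcritical_ground_state v u a m s"
  using dim ground_state exponents subcritical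
  by unfold_locales (auto simp: ground_state_def add.commute mult_ac)

lemma pos: "x \<noteq> 0 \<Longrightarrow> u x > 0"
  using ground_state by (simp add: ground_state_def)

lemma cont: "continuous_on UNIV u"
  using ground_state by (simp add: ground_state_def)

lemma equation:
  assumes "x \<noteq> 0"
  shows "\<exists>g. has_lap u x g (- (norm x powr a * u x powr s * v x powr (m + 1)))"
proof -
  have "- laplacian u x = norm x powr a * u x powr s * v x powr (m + 1)" "C2_on (- {0}) u"
    using assms ground_state by (simp_all add: ground_state_def)
  then show ?thesis using C2_on_has_lap[of "- {0}" u x] assms by (metis ComplI open_Compl closed_singleton minus_minus singletonD)
qed

lemma superharmonic: "x \<noteq> 0 \<Longrightarrow> \<exists>g L. has_lap u x g L \<and> L < 0"
  using equation[of x] pos[of x] subcritical_ground_state.pos[OF swap, of x] by force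

lemma kelvin_nonneg: "0 \<le> l \<Longrightarrow> x \<noteq> 0 \<Longrightarrow> 0 \<le> kelvin l u x"
  using pos[of "(l\<^sup>2 / (x \<bullet> x)) *\<^sub>R x"]
  by (cases "l = 0") (auto simp: kelvin_def intro!: mult_nonneg_nonneg)

text \<open>With \<open>q = l/|x| < 1\<close>, the left-hand side carries \<open>q\<close> to the power \<open>(n - 2) + 4 + 2a\<close> and the right-hand
  side to the power \<open>(n - 2)(s + m + 1)\<close>.  Subcriticality compares the two exponents.\<close>

lemma kelvin_strict_subsolution:
  assumes l: "0 < l" "l < norm x"
  shows "\<exists>g L. has_lap (kelvin l u) x g L \<and>
    - L < norm x powr a * kelvin l u x powr s * kelvin l v x powr (m + 1)"
proof -
  define n where "n = real DIM('a)"
  define q where "q = l / norm x"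
  define y where "y = (l\<^sup>2 / (x \<bullet> x)) *\<^sub>R x"
  have x: "x \<noteq> 0" "norm x > 0" using l by auto
  have q: "0 < q" "q < 1" using l x by (auto simp: q_def)
  have y0: "y \<noteq> 0" using x l by (simp add: y_def)
  have ny: "norm y = q\<^sup>2 * norm x"
    unfolding y_def norm_inversion q_def using x by (simp add: field_simps power2_eq_square)
  have nyp: "norm y powr a = q powr (2 * a) * norm x powr a"
    unfolding ny using q x by (simp add: powr_mult powr_powr flip: powr_numeral)
  have k: "l powr (n - 2) * norm x powr (2 - n) = q powr (n - 2)"
    unfolding q_def using x l by (simp add: powr_divide powr_diff field_simps)
  have kel: "kelvin l w x = q powr (n - 2) * w y" for w :: "'a \<Rightarrow> real"
    unfolding kelvin_def k[unfolded n_def] y_def n_def ..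
  have uv: "u y > 0" "v y > 0" using pos[OF y0] subcritical_ground_state.pos[OF swap, OF y0] by auto
  have Q: "l\<^sup>2 / (x \<bullet> x) = q\<^sup>2" by (simp add: q_def dot_square_norm power_divide)
  have q4: "(q\<^sup>2)\<^sup>2 = q powr 4" using q by (simp flip: power_mult)
  obtain g where "has_lap u y g (- (norm y powr a * u y powr s * v y powr (m + 1)))"
    using equation[OF y0] by blast
  from kelvin_has_lap[OF x(1) this[unfolded y_def]] obtain g' where
    g': "has_lap (kelvin l u) x g' (q powr (n - 2) * ((q\<^sup>2)\<^sup>2 * - (norm y powr a * u y powr s * v y powr (m + 1))))"
    unfolding k[unfolded n_def] Q n_def y_def by blast
  define X where "X = norm x powr a * u y powr s * v y powr (m + 1)"
  have X: "X > 0" using x uv by (simp add: X_def)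
  have "- (q powr (n - 2) * ((q\<^sup>2)\<^sup>2 * - (norm y powr a * u y powr s * v y powr (m + 1))))
     = q powr (n - 2 + 4 + 2 * a) * X"
    unfolding nyp q4 X_def powr_add[of q "n - 2 + 4"] powr_add[of q "n - 2" 4] by (simp only: mult_ac mult_minus_right minus_minus)
  also have "\<dots> < q powr ((n - 2) * (s + m + 1)) * X"
    using q X subcritical
    by (intro mult_strict_right_mono powr_less_mono') (auto simp: n_def mult.commute)
  also have "q powr ((n - 2) * (s + m + 1)) = q powr ((n - 2) * s) * q powr ((n - 2) * (m + 1))"
    by (simp add: algebra_simps flip: powr_add)
  also have "q powr ((n - 2) * s) * q powr ((n - 2) * (m + 1)) * X =
      norm x powr a * kelvin l u x powr s * kelvin l v x powr (m + 1)"
    unfolding kel X_def using q uv by (simp add: powr_mult powr_powr)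
  finally show ?thesis using g' by blast
qed

lemma difference_superharmonic:
  assumes l: "0 \<le> l" "l < norm x"
    and le: "kelvin l u x \<le> u x" "kelvin l v x \<le> v x"
  shows "\<exists>g L. has_lap (\<lambda>x. u x - kelvin l u x) x g L \<and> L < 0"
proof (cases "l = 0")
  case True
  then show ?thesis using superharmonic[of x] l by (auto simp: kelvin_def)
next
  case False
  have x: "x \<noteq> 0" using l by auto
  obtain g where 1: "has_lap u x g (- (norm x powr a * u x powr s * v x powr (m + 1)))"
    using equation[OF x] by blast
  obtain g' L where 2: "has_lap (kelvin l u) x g' L"
    "- L < norm x powr a * kelvin l u x powr s * kelvin l v x powr (m + 1)"
    using kelvin_strict_subsolution[of l x] l False by auto
  have "norm x powr a * kelvin l u x powr s * kelvin l v x powr (m + 1)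
     \<le> norm x powr a * u x powr s * v x powr (m + 1)"
    using le kelvin_nonneg[of l x] subcritical_ground_state.kelvin_nonneg[OF swap, of l x] l x exponents
    unfolding mult.assoc by (intro mult_left_mono mult_mono powr_mono2) auto
  then show ?thesis using has_lap_diff[OF 1 2(1)] 2(2)
    by (intro exI conjI) (assumption, linarith)
qed

lemma strict_domination:
  assumes l: "0 \<le> l" "l < norm x"
    and dom: "dominates_kelvin l u" "dominates_kelvin l v"
  shows "kelvin l u x < u x"
proof (rule ccontr)
  assume "\<not> kelvin l u x < u x"
  moreover have x: "x \<noteq> 0" using l by auto
  moreover have le: "kelvin l u y \<le> u y \<and> kelvin l v y \<le> v y" if "l < norm y" for y
    using that l dom unfolding dominates_kelvin_def by (cases "y = 0") auto
  ultimately have eq: "u x - kelvin l u x = 0" using l by force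
  obtain g L where L: "has_lap (\<lambda>x. u x - kelvin l u x) x g L" "L < 0"
    using difference_superharmonic[OF l] le[OF l(2)] by blast
  have "\<forall>\<^sub>F y in nhds x. y \<in> {y. l < norm y}"
    using l by (intro eventually_nhds_in_open open_Collect_less continuous_intros) auto
  then have "\<forall>\<^sub>F y in nhds x. u x - kelvin l u x \<le> u y - kelvin l u y"
    by eventually_elim (use le eq in auto)
  from has_lap_local_min_nonneg[OF L(1) this] L(2) show False by simp
qed

text \<open>The gap \<open>u - kelvin l0 u\<close> is at least \<open>c |x|\<^bsup>2-n\<^esup>\<close> beyond \<open>l0 + e\<close>.  Changing \<open>l0\<close> to \<open>l\<close> alters the
  Kelvin transform by less than that, by uniform continuity on the compact set of inverted points.\<close>

lemma far_step:
  assumes l0: "0 \<le> l0" and e: "0 < e"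
    and dom: "dominates_kelvin l0 u" "dominates_kelvin l0 v"
  shows "\<exists>d>0. \<forall>l x. l0 \<le> l \<longrightarrow> l \<le> l0 + d \<longrightarrow> l0 + e \<le> norm x \<longrightarrow> kelvin l u x \<le> u x"
proof -
  define n where "n = real DIM('a)"
  have n: "n > 2" using dim by (simp add: n_def)
  have "\<exists>c>0. \<forall>x. l0 + e \<le> norm x \<longrightarrow> c * norm x powr (2 - real DIM('a)) \<le> u x - kelvin l0 u x"
  proof (rule superharmonic_exterior_lower_bound[OF dim])
    show "continuous_on {x. l0 + e \<le> norm x} (\<lambda>x. u x - kelvin l0 u x)"
      using l0 e by (intro continuous_intros continuous_on_subset[OF cont]
          continuous_on_subset[OF continuous_on_kelvin[OF cont]]) auto
    show "u x - kelvin l0 u x > 0" if "l0 + e \<le> norm x" for x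
      using strict_domination[OF l0 _ dom, of x] that e by simp
    show "\<exists>g L. has_lap (\<lambda>x. u x - kelvin l0 u x) x g L \<and> L < 0" if "l0 + e < norm x" for x
      using difference_superharmonic[OF l0, of x] that dom e l0
      unfolding dominates_kelvin_def by (cases "x = 0") auto
  qed (use l0 e in auto)
  then obtain c where c: "c > 0"
    "\<And>x. l0 + e \<le> norm x \<Longrightarrow> c * norm x powr (2 - n) \<le> u x - kelvin l0 u x"
    unfolding n_def by blast
  define h where "h = (\<lambda>(l, y::'a). l powr (n - 2) * u (l\<^sup>2 *\<^sub>R y))"
  define C where "C = {l0..l0 + 1} \<times> cball (0::'a) (1 / e)"
  have "uniformly_continuous_on C h"
    unfolding C_def h_def split_def using n l0
    by (intro compact_uniformly_continuous compact_Times compact_cball compact_Icc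
        continuous_intros continuous_on_powr' continuous_on_compose2[OF cont]) auto
  then obtain d where d: "d > 0" "\<And>p q. p \<in> C \<Longrightarrow> q \<in> C \<Longrightarrow> dist p q < d \<Longrightarrow> dist (h p) (h q) < c"
    using c(1) unfolding uniformly_continuous_on_def by metis
  have "kelvin l u x \<le> u x" if l: "l0 \<le> l" "l \<le> l0 + min 1 (d / 2)" and x: "l0 + e \<le> norm x" for l x
  proof -
    define y where "y = x /\<^sub>R (x \<bullet> x)"
    have x0: "norm x > 0" using x l0 e by linarith
    have "norm y = 1 / norm x" using x0 by (simp add: y_def dot_square_norm power2_eq_square field_simps)
    also have "\<dots> \<le> 1 / e" using x l0 e x0 by (intro divide_left_mono) auto
    finally have y: "norm y \<le> 1 / e" .
    have "dist (h (l, y)) (h (l0, y)) < c"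
    proof (rule d(2))
      have "l \<le> l0 + 1" "l - l0 \<le> d / 2" using l(2) by linarith+
      then show "(l, y) \<in> C" "(l0, y) \<in> C" "dist (l, y) (l0, y) < d"
        using l y d(1) by (auto simp: C_def dist_Pair_Pair dist_norm)
    qed
    then have "h (l, y) \<le> h (l0, y) + c" by (simp add: dist_real_def)
    then have "norm x powr (2 - n) * h (l, y) \<le> norm x powr (2 - n) * (h (l0, y) + c)"
      by (intro mult_left_mono) auto
    moreover have "kelvin l' u x = norm x powr (2 - n) * h (l', y)" for l'
      by (simp add: kelvin_eq_inverted h_def n_def y_def)
    ultimately show ?thesis using c(2)[OF x] by (simp add: algebra_simps)
  qed
  then show ?thesis using d(1) by (intro exI[of _ "min 1 (d / 2)"]) auto
qed

text \<open>At a point where \<open>u - kelvin l u\<close> touches \<open>- d \<phi>\<close> from above, the Lipschitz bound for the nonlinearity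
  gives \<open>- \<Delta> (u - kelvin l u) \<ge> - B d |x|\<^sup>a\<close>, where \<open>B\<close> is the Lipschitz constant.  This is incompatible with a
  nonnegative Laplacian of \<open>u - kelvin l u + d \<phi>\<close> when \<open>- \<Delta> \<phi>\<close> exceeds \<open>B |x|\<^sup>a\<close>.\<close>

lemma no_touching:
  assumes l: "0 < l" "l < norm x" and x: "x \<in> interior S" and d: "0 < d"
    and c: "0 < c" "c \<le> u x" "c \<le> v x"
    and M: "0 \<le> M" "\<And>y. norm y \<le> l \<Longrightarrow> u y \<le> M" "\<And>y. norm y \<le> l \<Longrightarrow> v y \<le> M"
    and phi: "has_lap \<phi> x g \<Lambda>" "0 < \<phi> x" "\<phi> x \<le> 1"
      "\<Lambda> < - ((s + m + 1) * M powr (s + m + 1) / c) * norm x powr a"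
    and touch: "\<And>y. y \<in> S \<Longrightarrow> kelvin l u y \<le> u y + d * \<phi> y" "kelvin l u x = u x + d * \<phi> x"
      "kelvin l v x \<le> v x + d * \<phi> x"
  shows False
proof -
  have x0: "x \<noteq> 0" using l by auto
  define B where "B = (s + m + 1) * M powr (s + m + 1) / c"
  have B: "B \<ge> 0" using c exponents by (simp add: B_def)
  obtain g1 where 1: "has_lap u x g1 (- (norm x powr a * u x powr s * v x powr (m + 1)))"
    using equation[OF x0] by blast
  obtain g2 L where 2: "has_lap (kelvin l u) x g2 L"
    "- L < norm x powr a * kelvin l u x powr s * kelvin l v x powr (m + 1)"
    using kelvin_strict_subsolution[OF l] by auto
  have nn: "- (norm x powr a * u x powr s * v x powr (m + 1)) - L + d * \<Lambda> \<ge> 0"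
    by (rule has_lap_interior_min_nonneg[OF
          has_lap_add[OF has_lap_diff[OF 1 2(1)] has_lap_cmult[OF phi(1), of d]] x])
      (use touch in \<open>force simp: algebra_simps\<close>)
  have "kelvin l u x powr s * kelvin l v x powr (m + 1) - u x powr s * v x powr (m + 1)
     \<le> B * (d * \<phi> x)"
    unfolding B_def
    using c d phi touch M exponents kelvin_nonneg[of l x] subcritical_ground_state.kelvin_nonneg[OF swap, of l x] l x0
      kelvin_le[OF dim l(1), of x u M] kelvin_le[OF dim l(1), of x v M]
    by (intro homogeneous_lipschitz) auto
  also have "\<dots> \<le> B * (d * 1)" using B d phi by (intro mult_left_mono) auto
  finally have "norm x powr a * (kelvin l u x powr s * kelvin l v x powr (m + 1) - u x powr s * v x powr (m + 1))
      \<le> norm x powr a * (B * (d * 1))" by (intro mult_left_mono) auto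
  moreover have "d * \<Lambda> < d * (- B * norm x powr a)"
    using d phi(4) unfolding B_def by (intro mult_strict_left_mono) auto
  ultimately show False using nn 2(2) by (simp add: algebra_simps)
qed

text \<open>The weight \<open>\<phi> = 1 - K (|x|\<^sup>b - l0\<^sup>b)\<^sup>2\<close> with \<open>b = (a + 2)/2\<close> satisfies \<open>- \<Delta> \<phi> \<ge> 2 K b\<^sup>2 |x|\<^sup>a\<close> outside the
  sphere of radius \<open>l0\<close>.  The constant \<open>K\<close> is as large as the nonlinearity demands, and then \<open>\<phi>\<close> lies in
  \<open>(0, 1]\<close> on a sufficiently narrow annulus.  If domination failed there, the least of the two quotients
  by \<open>\<phi>\<close> would be attained inside, against \<open>no_touching\<close>.  The exponent \<open>b\<close> makes the singular weight
  \<open>|x|\<^sup>a\<close> appear exactly, which covers \<open>l0 = 0\<close> as well.\<close>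

lemma near_step:
  assumes l0: "0 \<le> l0"
  shows "\<exists>e>0. \<forall>l x. l0 \<le> l \<longrightarrow> 0 < l \<longrightarrow> l < l0 + e \<longrightarrow>
       (\<forall>y. norm y = l0 + e \<longrightarrow> kelvin l u y \<le> u y \<and> kelvin l v y \<le> v y) \<longrightarrow>
       l \<le> norm x \<longrightarrow> norm x \<le> l0 + e \<longrightarrow> kelvin l u x \<le> u x \<and> kelvin l v x \<le> v x"
proof -
  define n where "n = real DIM('a)"
  define b where "b = (a + 2) / 2"
  have b: "b > 0" using exponents by (simp add: b_def)
  define R where "R = l0 + 1"
  have R: "R > 0" using l0 by (simp add: R_def)
  obtain cu where cu: "cu > 0" "\<And>x. x \<noteq> 0 \<Longrightarrow> norm x \<le> R \<Longrightarrow> cu \<le> u x"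
    using superharmonic_punctured_lower_bound[OF dim R pos superharmonic] by blast
  obtain cv where cv: "cv > 0" "\<And>x. x \<noteq> 0 \<Longrightarrow> norm x \<le> R \<Longrightarrow> cv \<le> v x"
    using superharmonic_punctured_lower_bound[OF dim R subcritical_ground_state.pos[OF swap] subcritical_ground_state.superharmonic[OF swap]] by blast
  define c where "c = min cu cv"
  have c: "c > 0" "\<And>x. x \<noteq> 0 \<Longrightarrow> norm x \<le> R \<Longrightarrow> c \<le> u x" "\<And>x. x \<noteq> 0 \<Longrightarrow> norm x \<le> R \<Longrightarrow> c \<le> v x"
    using cu cv by (force simp: c_def)+
  have bdd: "\<exists>M. \<forall>x. norm x \<le> R \<longrightarrow> w x \<le> M" if "continuous_on UNIV w" for w :: "'a \<Rightarrow> real"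
  proof -
    have "\<exists>z\<in>cball 0 R. \<forall>x\<in>cball 0 R. w x \<le> w z"
      using R by (intro continuous_attains_sup continuous_on_subset[OF that]) auto
    then obtain z where "\<forall>x\<in>cball 0 R. w x \<le> w z" by blast
    then show ?thesis by (intro exI[of _ "w z"]) auto
  qed
  obtain Mu where Mu: "\<And>x. norm x \<le> R \<Longrightarrow> u x \<le> Mu"
    using bdd[OF cont] by blast
  obtain Mv where Mv: "\<And>x. norm x \<le> R \<Longrightarrow> v x \<le> Mv"
    using bdd[OF subcritical_ground_state.cont[OF swap]] by blast
  define M where "M = max 0 (max Mu Mv)"
  have M: "M \<ge> 0" "\<And>x. norm x \<le> R \<Longrightarrow> u x \<le> M" "\<And>x. norm x \<le> R \<Longrightarrow> v x \<le> M"
    using Mu Mv by (force simp: M_def)+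
  define B where "B = (s + m + 1) * M powr (s + m + 1) / c"
  have B: "B \<ge> 0" using c exponents by (simp add: B_def)
  define K where "K = (B + 1) / (2 * b\<^sup>2)"
  have K: "K > 0" "B < K * (2 * b\<^sup>2)" using B b by (auto simp: K_def)
  have "continuous_on {0..} (\<lambda>t. K * (t powr b - l0 powr b)\<^sup>2)"
    using b by (intro continuous_intros continuous_on_powr') auto
  from this[unfolded continuous_on_iff, rule_format, of l0 "1 / 2"] l0
  obtain d0 where d0: "d0 > 0"
    "\<And>t. 0 \<le> t \<Longrightarrow> dist t l0 < d0 \<Longrightarrow> dist (K * (t powr b - l0 powr b)\<^sup>2) 0 < 1 / 2"
    by auto
  define e where "e = min 1 (d0 / 2)"
  have e: "0 < e" "e \<le> 1" "e < d0" using d0 by (auto simp: e_def)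
  define \<phi> where "\<phi> = (\<lambda>x::'a. 1 - K * (norm x powr b - l0 powr b)\<^sup>2)"
  have phi: "0 < \<phi> x" "\<phi> x \<le> 1" if "l0 \<le> norm x" "norm x \<le> l0 + e" for x
    using d0(2)[of "norm x"] that e K(1) l0 by (auto simp: \<phi>_def dist_real_def)
  have lap_phi: "\<exists>g \<Lambda>. has_lap \<phi> x g \<Lambda> \<and> \<Lambda> < - B * norm x powr a"
    if x: "x \<noteq> 0" "l0 \<le> norm x" for x
  proof -
    define y where "y = norm x powr (b - 2)"
    have y: "y > 0" using x by (simp add: y_def)
    have ya: "norm x powr a = y * norm x powr b"
      by (simp add: y_def b_def field_simps flip: powr_add)
    have y2: "norm x powr (2 * b - 2) = y * norm x powr b"
      by (simp add: y_def flip: powr_add)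
    have e: "\<phi> = (\<lambda>x. 1 + (- K) * (norm x powr (2 * b) + ((- 2 * l0 powr b) * norm x powr b + l0 powr (2 * b))))"
      unfolding \<phi>_def mult_2 powr_add by (simp add: fun_eq_iff power2_eq_square algebra_simps)
    \<comment> \<open>The Laplacian of \<open>(|x|\<^sup>b - l0\<^sup>b)\<^sup>2\<close>, a combination of the powers \<open>2b\<close> and \<open>b\<close> of \<open>|x|\<close>.\<close>
    define S where "S = 2 * b * (2 * b + n - 2) * norm x powr (2 * b - 2)
       + ((- 2 * l0 powr b) * (b * (b + n - 2) * norm x powr (b - 2)) + 0)"
    have has: "\<exists>g. has_lap \<phi> x g (0 + (- K) * S)"
      unfolding e S_def n_def
      by (rule exI) (rule has_lap_add[OF has_lap_const has_lap_cmult[OF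
            has_lap_add[OF has_lap_norm_powr[OF x(1)]
              has_lap_add[OF has_lap_cmult[OF has_lap_norm_powr[OF x(1)]] has_lap_const]]]])
    have "S \<ge> 2 * b\<^sup>2 * norm x powr a"
    proof -
      have "S = 2 * b * y * ((2 * b + n - 2) * norm x powr b - (b + n - 2) * l0 powr b)"
        unfolding S_def y2 y_def[symmetric] by (simp add: algebra_simps)
      also have "\<dots> \<ge> 2 * b * y * (b * norm x powr b)"
      proof (intro mult_left_mono)
        have "(b + n - 2) * l0 powr b \<le> (b + n - 2) * norm x powr b"
          using x l0 b dim by (intro mult_left_mono powr_mono2) (auto simp: n_def)
        then show "b * norm x powr b \<le> (2 * b + n - 2) * norm x powr b - (b + n - 2) * l0 powr b"
          by (simp add: algebra_simps)
      qed (use b y in auto)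
      finally show ?thesis unfolding ya by (simp add: power2_eq_square mult_ac)
    qed
    then have "K * (2 * b\<^sup>2 * norm x powr a) \<le> K * S" using K by (intro mult_left_mono) auto
    moreover have "B * norm x powr a < K * (2 * b\<^sup>2) * norm x powr a"
      using x by (intro mult_strict_right_mono K(2)) simp
    ultimately have "B * norm x powr a < K * S" by (simp only: mult.assoc)
    then have "0 + (- K) * S < - B * norm x powr a" by simp
    with has show ?thesis by blast
  qed
  have "kelvin l u x \<le> u x \<and> kelvin l v x \<le> v x"
    if l: "l0 \<le> l" "0 < l" "l < l0 + e"
      and bnd: "\<forall>y. norm y = l0 + e \<longrightarrow> kelvin l u y \<le> u y \<and> kelvin l v y \<le> v y"
      and x: "l \<le> norm x" "norm x \<le> l0 + e" for l :: real and x :: 'a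
  proof -
    define A where "A = (annulus l (l0 + e) :: 'a set)"
    define w where "w = (\<lambda>y. min ((u y - kelvin l u y) / \<phi> y) ((v y - kelvin l v y) / \<phi> y))"
    have phiA: "0 < \<phi> y" "\<phi> y \<le> 1" "y \<noteq> 0" if "y \<in> A" for y
      using phi[of y] that l by (auto simp: A_def annulus_def)
    have "\<exists>y\<in>A. \<forall>y'\<in>A. w y \<le> w y'"
    proof (rule continuous_attains_inf)
      show "compact A" unfolding A_def by (rule compact_annulus)
      show "A \<noteq> {}" using x by (auto simp: A_def annulus_def)
      have sub: "A \<subseteq> - {0}" using phiA(3) by auto
      have "continuous_on A \<phi>" unfolding \<phi>_def using sub by (intro continuous_intros) auto
      then show "continuous_on A w"
        unfolding w_def using phiA(1)
        by (intro continuous_intros continuous_on_subset[OF cont] continuous_on_subset[OF subcritical_ground_state.cont[OF swap]]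
            continuous_on_subset[OF continuous_on_kelvin[OF cont] sub]
            continuous_on_subset[OF continuous_on_kelvin[OF subcritical_ground_state.cont[OF swap]] sub]) (auto simp: less_le)
    qed
    then obtain y where y: "y \<in> A" "\<And>y'. y' \<in> A \<Longrightarrow> w y \<le> w y'" by blast
    have "w y \<ge> 0"
    proof (rule ccontr)
      assume neg: "\<not> w y \<ge> 0"
      define d where "d = - w y"
      have d: "d > 0" using neg by (simp add: d_def)
      have ge: "kelvin l u z \<le> u z + d * \<phi> z" "kelvin l v z \<le> v z + d * \<phi> z" if z: "z \<in> A" for z
        using y(2)[OF z] phiA(1)[OF z] unfolding w_def[THEN fun_cong, of z] d_def
        by (simp_all add: field_simps)
      have "norm y \<noteq> l"
      proof
        assume "norm y = l"
        from kelvin_fixed[OF l(2) this] neg show False by (simp add: w_def)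
      qed
      moreover have "norm y \<noteq> l0 + e"
        using bnd neg phiA[OF y(1)] by (auto simp: w_def)
      ultimately have y': "l < norm y" "norm y < l0 + e" using y(1) by (auto simp: A_def annulus_def)
      have int: "y \<in> interior A" unfolding A_def by (rule interior_annulus[OF y'])
      have yR: "norm y \<le> R" "l \<le> R" using y' e l by (auto simp: R_def)
      have Ml: "\<And>y. norm y \<le> l \<Longrightarrow> u y \<le> M" "\<And>y. norm y \<le> l \<Longrightarrow> v y \<le> M"
        using M yR(2) by auto
      obtain g \<Lambda> where \<Lambda>: "has_lap \<phi> y g \<Lambda>" "\<Lambda> < - B * norm y powr a"
        using lap_phi[OF phiA(3)[OF y(1)]] y' l by auto
      note cy = c(2,3)[OF phiA(3)[OF y(1)] yR(1)]
      have "(u y - kelvin l u y) / \<phi> y = - d \<or> (v y - kelvin l v y) / \<phi> y = - d"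
        by (simp add: d_def w_def min_def)
      then consider "kelvin l u y = u y + d * \<phi> y" | "kelvin l v y = v y + d * \<phi> y"
        using phiA(1)[OF y(1)] by (auto simp: field_simps)
      then show False
      proof cases
        case 1
        show False
          by (rule no_touching[OF l(2) y'(1) int d c(1) cy M(1) Ml \<Lambda>(1) phiA(1,2)[OF y(1)]
                \<Lambda>(2)[unfolded B_def] ge(1) 1 ge(2)[OF y(1)]])
      next
        case 2
        have "\<Lambda> < - ((m + s + 1) * M powr (m + s + 1) / c) * norm y powr a"
          using \<Lambda>(2) by (simp add: B_def add.commute)
        from subcritical_ground_state.no_touching[OF swap, OF l(2) y'(1) int d c(1) cy(2,1) M(1) Ml(2,1) \<Lambda>(1) phiA(1,2)[OF y(1)]
            this ge(2) 2 ge(1)[OF y(1)]]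
        show False .
      qed
    qed
    moreover have "x \<in> A" using x by (simp add: A_def annulus_def)
    ultimately have "0 \<le> w x" using y(2)[of x] by simp
    then show ?thesis
      using phiA(1)[OF \<open>x \<in> A\<close>] by (simp add: w_def zero_le_divide_iff)
  qed
  then show ?thesis
    by (intro exI[of _ e], intro conjI[OF e(1)] allI impI)
qed

lemma domination_step:
  assumes l0: "0 \<le> l0" and dom: "dominates_kelvin l0 u" "dominates_kelvin l0 v"
  shows "\<exists>d>0. \<forall>l. l0 \<le> l \<longrightarrow> l \<le> l0 + d \<longrightarrow> dominates_kelvin l u \<and> dominates_kelvin l v"
proof -
  obtain e where e: "0 < e"
    "\<And>l x. l0 \<le> l \<Longrightarrow> 0 < l \<Longrightarrow> l < l0 + e \<Longrightarrow>
       \<forall>y. norm y = l0 + e \<longrightarrow> kelvin l u y \<le> u y \<and> kelvin l v y \<le> v y \<Longrightarrow>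
       l \<le> norm x \<Longrightarrow> norm x \<le> l0 + e \<Longrightarrow> kelvin l u x \<le> u x \<and> kelvin l v x \<le> v x"
    using near_step[OF l0] by (elim exE conjE) metis
  obtain du where du: "du > 0"
    "\<And>l x. l0 \<le> l \<Longrightarrow> l \<le> l0 + du \<Longrightarrow> l0 + e \<le> norm x \<Longrightarrow> kelvin l u x \<le> u x"
    using far_step[OF l0 e(1) dom] by blast
  obtain dv where dv: "dv > 0"
    "\<And>l x. l0 \<le> l \<Longrightarrow> l \<le> l0 + dv \<Longrightarrow> l0 + e \<le> norm x \<Longrightarrow> kelvin l v x \<le> v x"
    using subcritical_ground_state.far_step[OF swap l0 e(1) dom(2,1)] by blast
  define d where "d = min (e / 2) (min du dv)"
  have d: "d > 0" "d < e" "d \<le> du" "d \<le> dv" using e(1) du(1) dv(1) by (auto simp: d_def)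
  have "kelvin l u x \<le> u x \<and> kelvin l v x \<le> v x"
    if l: "l0 \<le> l" "l \<le> l0 + d" and x: "l \<le> norm x" "x \<noteq> 0" for l x
  proof (cases "l = l0")
    case True
    then show ?thesis using dom x by (auto simp: dominates_kelvin_def)
  next
    case False
    have far: "kelvin l u y \<le> u y \<and> kelvin l v y \<le> v y" if "l0 + e \<le> norm y" for y
      using du(2)[of l y] dv(2)[of l y] that l d by simp
    show ?thesis
    proof (cases "l0 + e \<le> norm x")
      case True
      then show ?thesis by (rule far)
    next
      case outer: False
      show ?thesis by (rule e(2)[OF l(1)]) (use far False outer l x d l0 in auto)
    qed
  qed
  then show ?thesis using d(1) unfolding dominates_kelvin_def by blast
qed

lemma dominates_kelvin_closed:
  assumes l: "0 < l" and below: "\<And>k. 0 \<le> k \<Longrightarrow> k < l \<Longrightarrow> dominates_kelvin k u"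
  shows "dominates_kelvin l u"
  unfolding dominates_kelvin_def
proof (intro allI impI)
  fix x :: 'a assume x: "x \<noteq> 0" "l \<le> norm x"
  have c: "continuous_on UNIV (\<lambda>k. u ((k\<^sup>2 / (x \<bullet> x)) *\<^sub>R x))"
    using x by (intro continuous_on_compose2[OF cont] continuous_intros) auto
  have "((\<lambda>k. kelvin k u x) \<longlongrightarrow> kelvin l u x) (at_left l)"
    unfolding kelvin_def
    using continuous_on_tendsto_compose[OF c tendsto_ident_at, of l "{..<l}"] l
    by (intro tendsto_intros) auto
  moreover have "\<forall>\<^sub>F k in at_left l. kelvin k u x \<le> u x"
    using eventually_at_left_real[OF l]
    by eventually_elim (use below x in \<open>auto simp: dominates_kelvin_def\<close>)
  ultimately show "kelvin l u x \<le> u x"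
    by (rule tendsto_upperbound) simp
qed

text \<open>At the infimum \<open>l0\<close> of the radii without domination, domination holds by continuity in \<open>l\<close>, or because
  the Kelvin transform vanishes if \<open>l0 = 0\<close>; it then persists beyond \<open>l0\<close>.\<close>

lemma dominates_kelvin_all:
  assumes "0 \<le> l"
  shows "dominates_kelvin l u \<and> dominates_kelvin l v"
proof (rule ccontr)
  define bad where "bad = {l. 0 \<le> l \<and> \<not> (dominates_kelvin l u \<and> dominates_kelvin l v)}"
  assume "\<not> ?thesis"
  then have ne: "bad \<noteq> {}" using assms by (auto simp: bad_def)
  have bdd: "bdd_below bad" by (auto simp: bad_def intro!: bdd_belowI[of _ 0])
  define l0 where "l0 = Inf bad"
  have l0: "0 \<le> l0" unfolding l0_def by (rule cInf_greatest[OF ne]) (simp add: bad_def)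
  have below: "dominates_kelvin k u \<and> dominates_kelvin k v" if "0 \<le> k" "k < l0" for k
  proof -
    have "k \<notin> bad" using cInf_lower[OF _ bdd, of k] that(2) by (auto simp: l0_def)
    then show ?thesis using that(1) by (simp add: bad_def)
  qed
  have good: "dominates_kelvin l0 u" "dominates_kelvin l0 v"
  proof -
    show "dominates_kelvin l0 u"
    proof (cases "l0 = 0")
      case True
      then show ?thesis using pos by (auto simp: dominates_kelvin_def kelvin_def less_imp_le)
    qed (use l0 below in \<open>auto intro: dominates_kelvin_closed\<close>)
    show "dominates_kelvin l0 v"
    proof (cases "l0 = 0")
      case True
      then show ?thesis using subcritical_ground_state.pos[OF swap]
        by (auto simp: dominates_kelvin_def kelvin_def less_imp_le)
    qed (use l0 below in \<open>auto intro: subcritical_ground_state.dominates_kelvin_closed[OF swap]\<close>)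
  qed
  obtain d where d: "d > 0"
    "\<And>l. l0 \<le> l \<Longrightarrow> l \<le> l0 + d \<Longrightarrow> dominates_kelvin l u \<and> dominates_kelvin l v"
    using domination_step[OF l0 good] by blast
  obtain k where k: "k \<in> bad" "k < l0 + d"
    using cInf_lessD[OF ne, of "l0 + d"] d(1) by (auto simp: l0_def)
  have "l0 \<le> k" unfolding l0_def by (rule cInf_lower[OF k(1) bdd])
  with d(2)[of k] k show False by (simp add: bad_def)
qed

section \<open>Decay bound and nonexistence\<close>

text \<open>The sphere of radius \<open>sqrt |x|\<close> reflects \<open>x\<close> to the unit sphere, where \<open>u\<close> has a positive minimum.\<close>

lemma decay_lower_bound:
  "\<exists>c>0. \<forall>x. 1 \<le> norm x \<longrightarrow> c * norm x powr (- ((real DIM('a) - 2) / 2)) \<le> u x"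
proof -
  have c1: "continuous_on (sphere 0 1) u" using continuous_on_subset[OF cont] by blast
  have "\<exists>z\<in>sphere 0 1. \<forall>y\<in>sphere 0 1. u z \<le> u y"
    using sphere_nonempty[of 1, where 'a='a] by (intro continuous_attains_inf c1) auto
  then obtain z where z: "norm z = 1" "\<And>y. norm y = 1 \<Longrightarrow> u z \<le> u y" by auto
  have "u z * norm x powr (- ((real DIM('a) - 2) / 2)) \<le> u x" if x: "1 \<le> norm x" for x
  proof -
    define l where "l = sqrt (norm x)"
    have x0: "norm x > 0" using x by linarith
    have "l \<le> norm x" unfolding l_def using x mult_left_mono[OF x, of "norm x"]
      by (intro real_le_lsqrt) (auto simp: power2_eq_square)
    moreover have l: "0 \<le> l" "l\<^sup>2 = norm x" by (simp_all add: l_def)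
    ultimately have le: "kelvin l u x \<le> u x"
      using dominates_kelvin_all[of l] x0 by (auto simp: dominates_kelvin_def)
    have "norm ((l\<^sup>2 / (x \<bullet> x)) *\<^sub>R x) = 1" by (subst norm_inversion) (use l(2) x0 in simp)
    from z(2)[OF this] have "u z \<le> u ((l\<^sup>2 / (x \<bullet> x)) *\<^sub>R x)" .
    moreover have "l powr (real DIM('a) - 2) * norm x powr (2 - real DIM('a))
        = norm x powr (- ((real DIM('a) - 2) / 2))"
    proof -
      have e: "- ((real DIM('a) - 2) / 2) = (2 - real DIM('a)) / 2" by (simp add: field_simps)
      show ?thesis unfolding l_def e using x0
        by (simp add: powr_half_sqrt[symmetric] powr_powr field_simps flip: powr_add)
    qed
    ultimately have "norm x powr (- ((real DIM('a) - 2) / 2)) * u z \<le> kelvin l u x"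
      unfolding kelvin_def by (simp add: mult_left_mono)
    with le show ?thesis by (simp add: mult.commute)
  qed
  moreover have "u z > 0" using z(1) by (intro pos) auto
  ultimately show ?thesis by blast
qed

text \<open>At the touching point put \<open>\<rho> = R\<^sup>2 - |x - x0|\<^sup>2\<close>.  The bump \<open>\<rho>\<^sup>2\<close> has
  \<open>- \<Delta> \<rho>\<^sup>2 = (4 n + 8) \<rho> - 8 R\<^sup>2\<close>, and this is at most \<open>(n + 2)\<^sup>2 / (2 R\<^sup>2)\<close> times \<open>\<rho>\<^sup>2\<close>, since the
  difference is a perfect square.  Near the boundary of the ball \<open>- \<Delta> \<rho>\<^sup>2\<close> is negative, which is why the
  quotient by \<open>\<rho>\<^sup>2\<close> stays bounded above although the bump vanishes there.\<close>

lemma no_bump_touching: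
  assumes x: "x \<in> ball x0 R" "x \<noteq> 0" and t: "t > 0"
    and le: "\<And>y. y \<in> ball x0 R \<Longrightarrow> t * (R\<^sup>2 - (y - x0) \<bullet> (y - x0))\<^sup>2 \<le> u y"
    and eq: "t * (R\<^sup>2 - (x - x0) \<bullet> (x - x0))\<^sup>2 = u x" and uv: "u x \<le> v x"
    and large: "(real DIM('a) + 2)\<^sup>2 / (2 * R\<^sup>2) < norm x powr a * u x powr (s + m)"
  shows False
proof -
  define n where "n = real DIM('a)"
  define \<rho> where "\<rho> = (\<lambda>y. R\<^sup>2 - (y - x0) \<bullet> (y - x0))"
  have R: "R > 0" using x(1) by (metis ball_eq_empty empty_iff not_le)
  have ux: "u x > 0" using pos[OF x(2)] .
  have lap_rho: "has_lap \<rho> x ((- 2) *\<^sub>R (x - x0)) (- 2 * n)"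
  proof (rule has_lapI[where G="\<lambda>y. (- 2) *\<^sub>R (y - x0)" and H="\<lambda>h. (- 2) *\<^sub>R h"])
    have "(\<rho> has_derivative (\<lambda>h. (- 2) *\<^sub>R (y - x0) \<bullet> h)) (at y)" for y
      unfolding \<rho>_def by (auto intro!: derivative_eq_intros simp: inner_commute algebra_simps)
    then show "\<forall>\<^sub>F y in nhds x. (\<rho> has_derivative (\<lambda>h. (- 2) *\<^sub>R (y - x0) \<bullet> h)) (at y)" by simp
    show "((\<lambda>y. (- 2) *\<^sub>R (y - x0)) has_derivative (\<lambda>h. (- 2) *\<^sub>R h)) (at x)"
      by (auto intro!: derivative_eq_intros)
  qed (auto simp: n_def)
  obtain g where "has_lap u x g (- (norm x powr a * u x powr s * v x powr (m + 1)))"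
    using equation[OF x(2)] by blast
  from has_lap_diff[OF this has_lap_cmult[OF has_lap_mult[OF lap_rho lap_rho], of t]]
  obtain g' where g': "has_lap (\<lambda>y. u y - t * (\<rho> y * \<rho> y)) x g'
      (- (norm x powr a * u x powr s * v x powr (m + 1))
       - t * (\<rho> x * (- 2 * n) + \<rho> x * (- 2 * n) + 2 * ((- 2) *\<^sub>R (x - x0) \<bullet> (- 2) *\<^sub>R (x - x0))))"
    by blast
  have nn: "- (norm x powr a * u x powr s * v x powr (m + 1))
       - t * (\<rho> x * (- 2 * n) + \<rho> x * (- 2 * n) + 2 * ((- 2) *\<^sub>R (x - x0) \<bullet> (- 2) *\<^sub>R (x - x0))) \<ge> 0"
  proof (rule has_lap_interior_min_nonneg[OF g'])
    show "x \<in> interior (ball x0 R)" using x(1) by (simp add: interior_open)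
    show "u x - t * (\<rho> x * \<rho> x) \<le> u y - t * (\<rho> y * \<rho> y)" if "y \<in> ball x0 R" for y
      using le[OF that] eq by (simp add: \<rho>_def power2_eq_square)
  qed
  have e: "(- 2) *\<^sub>R (x - x0) \<bullet> (- 2) *\<^sub>R (x - x0) = 4 * (R\<^sup>2 - \<rho> x)"
    by (simp add: \<rho>_def)
  have 1: "norm x powr a * u x powr s * v x powr (m + 1) \<le>
      t * ((4 * n + 8) * \<rho> x - 8 * R\<^sup>2)"
    using nn unfolding e by (simp add: algebra_simps)
  have "(n + 2)\<^sup>2 / (2 * R\<^sup>2) * u x < norm x powr a * u x powr (s + m) * u x"
    using large ux unfolding n_def by (intro mult_strict_right_mono)
  also have "\<dots> = norm x powr a * u x powr s * u x powr (m + 1)"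
    using ux by (simp add: powr_add)
  also have "\<dots> \<le> norm x powr a * u x powr s * v x powr (m + 1)"
    using uv ux exponents by (intro mult_left_mono powr_mono2) auto
  also note 1
  also have "(n + 2)\<^sup>2 / (2 * R\<^sup>2) * u x = t * ((n + 2)\<^sup>2 / (2 * R\<^sup>2) * (\<rho> x)\<^sup>2)"
    using eq by (simp add: \<rho>_def)
  finally have "(n + 2)\<^sup>2 / (2 * R\<^sup>2) * (\<rho> x)\<^sup>2 < (4 * n + 8) * \<rho> x - 8 * R\<^sup>2"
    using t by (simp only: mult_less_cancel_left_pos)
  moreover have "(n + 2)\<^sup>2 / (2 * R\<^sup>2) * (\<rho> x)\<^sup>2 - ((4 * n + 8) * \<rho> x - 8 * R\<^sup>2)
      = 8 * (R - (n + 2) * \<rho> x / (4 * R))\<^sup>2"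
    using R by (simp add: power2_eq_square field_simps)
  moreover have "8 * (R - (n + 2) * \<rho> x / (4 * R))\<^sup>2 \<ge> 0" by simp
  ultimately show False by linarith
qed

text \<open>The touching point is where the quotient of the bump by \<open>min u v\<close> is largest, and the factor \<open>t\<close> is the
  inverse of that largest value.  The radius is chosen so that the lower bound
  \<open>u, v \<ge> c |x|\<^bsup>-(n-2)/2\<^esup>\<close> makes the potential exceed \<open>(n + 2)\<^sup>2 / (2 R\<^sup>2)\<close> on the whole ball.\<close>

lemma no_ground_state: False
proof -
  define \<alpha> where "\<alpha> = (real DIM('a) - 2) / 2"
  define \<delta> where "\<delta> = a - \<alpha> * (s + m) + 2"
  have delta: "\<delta> > 0" using subcritical by (simp add: \<delta>_def \<alpha>_def field_simps)
  obtain cu where cu: "cu > 0" "\<And>x. 1 \<le> norm x \<Longrightarrow> cu * norm x powr (- \<alpha>) \<le> u x"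
    using decay_lower_bound unfolding \<alpha>_def by blast
  obtain cv where cv: "cv > 0" "\<And>x. 1 \<le> norm x \<Longrightarrow> cv * norm x powr (- \<alpha>) \<le> v x"
    using subcritical_ground_state.decay_lower_bound[OF swap] unfolding \<alpha>_def by blast
  define c where "c = min cu cv"
  have c: "c > 0" using cu cv by (simp add: c_def)
  have lower: "c * norm x powr (- \<alpha>) \<le> u x" "c * norm x powr (- \<alpha>) \<le> v x" if "1 \<le> norm x" for x
    using cu(2)[OF that] cv(2)[OF that] mult_right_mono[of c cu "norm x powr (- \<alpha>)"]
      mult_right_mono[of c cv "norm x powr (- \<alpha>)"] by (auto simp: c_def)
  \<comment> \<open>The factor \<open>9\<close> accounts for \<open>|y| \<le> 3R\<close> on the ball around \<open>x0\<close>.\<close>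
  define C where "C = 9 * ((real DIM('a) + 2)\<^sup>2 / 2) / c powr (s + m)"
  have C: "C > 0" using c by (simp add: C_def)
  define R where "R = max 1 ((C + 1) powr (1 / \<delta>))"
  have R: "R \<ge> 1" by (simp add: R_def)
  have RC: "C < R powr \<delta>"
  proof -
    have "((C + 1) powr (1 / \<delta>)) powr \<delta> \<le> R powr \<delta>"
      using delta by (intro powr_mono2) (auto simp: R_def)
    then show ?thesis using delta C by (simp add: powr_powr)
  qed
  obtain x0 :: 'a where x0: "norm x0 = 2 * R" using sphere_nonempty[of "2 * R"] R by auto
  have ball: "R \<le> norm y" "norm y \<le> 3 * R" if "y \<in> cball x0 R" for y
    using that x0 norm_triangle_ineq2[of x0 y] norm_triangle_ineq2[of y x0]
    by (auto simp: dist_norm norm_minus_commute)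
  have large: "(real DIM('a) + 2)\<^sup>2 / (2 * R\<^sup>2) < norm y powr a * w powr (s + m)"
    if y: "y \<in> cball x0 R" and w: "c * norm y powr (- \<alpha>) \<le> w" for y w
  proof -
    have y0: "norm y > 0" using ball(1)[OF y] R by linarith
    have "(real DIM('a) + 2)\<^sup>2 / (2 * R\<^sup>2) = c powr (s + m) * C / (9 * R\<^sup>2)"
      using c by (simp add: C_def)
    also have "\<dots> < c powr (s + m) * R powr \<delta> / (9 * R\<^sup>2)"
      using RC c R by (intro divide_strict_right_mono mult_strict_left_mono) auto
    also have "\<dots> \<le> c powr (s + m) * norm y powr \<delta> / (9 * R\<^sup>2)"
      using ball(1)[OF y] delta R
      by (intro divide_right_mono mult_left_mono powr_mono2) auto
    also have "\<dots> \<le> c powr (s + m) * norm y powr \<delta> / (norm y)\<^sup>2"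
    proof (rule divide_left_mono)
      have "(norm y)\<^sup>2 \<le> (3 * R)\<^sup>2" using ball(2)[OF y] by (intro power_mono) auto
      then show "(norm y)\<^sup>2 \<le> 9 * R\<^sup>2" by (simp add: power_mult_distrib)
    qed (use y0 R in auto)
    also have "\<dots> = norm y powr a * (c * norm y powr (- \<alpha>)) powr (s + m)"
    proof -
      have "norm y powr \<delta> / (norm y)\<^sup>2 = norm y powr (\<delta> - 2)"
        using y0 by (simp add: powr_diff)
      also have "\<dots> = norm y powr a * norm y powr (- \<alpha> * (s + m))"
        by (simp add: \<delta>_def flip: powr_add)
      finally have e: "norm y powr \<delta> / (norm y)\<^sup>2 = norm y powr a * norm y powr (- \<alpha> * (s + m))" .
      show ?thesis unfolding times_divide_eq_right[symmetric] e
        using c by (simp add: powr_mult powr_powr)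
    qed
    also have "\<dots> \<le> norm y powr a * w powr (s + m)"
      using w c exponents by (intro mult_left_mono powr_mono2) auto
    finally show ?thesis .
  qed
  define \<phi> where "\<phi> = (\<lambda>y. (R\<^sup>2 - (y - x0) \<bullet> (y - x0))\<^sup>2)"
  have ne: "y \<noteq> 0" if "y \<in> cball x0 R" for y using ball(1)[OF that] R by auto
  define z where "z = (\<lambda>y. min (u y) (v y))"
  have z: "z y > 0" if "y \<in> cball x0 R" for y
    using pos[OF ne[OF that]] subcritical_ground_state.pos[OF swap ne[OF that]] by (simp add: z_def)
  have "continuous_on (cball x0 R) (\<lambda>y. \<phi> y / z y)"
    unfolding \<phi>_def
    by (intro continuous_intros)
      (use z in \<open>auto simp: z_def less_le intro!: continuous_intros continuous_on_subset[OF cont]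
         continuous_on_subset[OF subcritical_ground_state.cont[OF swap]]\<close>)
  then have "\<exists>x\<in>cball x0 R. \<forall>y\<in>cball x0 R. \<phi> y / z y \<le> \<phi> x / z x"
    using R by (intro continuous_attains_sup) auto
  then obtain x where x: "x \<in> cball x0 R" "\<And>y. y \<in> cball x0 R \<Longrightarrow> \<phi> y / z y \<le> \<phi> x / z x" by blast
  have "\<phi> x0 / z x0 > 0" using z[of x0] R by (simp add: \<phi>_def)
  then have "\<phi> x / z x > 0" using x(2)[of x0] R by simp
  then have phix: "\<phi> x > 0" using z[OF x(1)] by (simp add: zero_less_divide_iff)
  define t where "t = z x / \<phi> x"
  have t: "t > 0" using phix z[OF x(1)] by (simp add: t_def)
  have le: "t * \<phi> y \<le> z y" if "y \<in> cball x0 R" for y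
    using x(2)[OF that] z[OF that] z[OF x(1)] phix unfolding t_def by (simp add: field_simps)
  have eq: "t * \<phi> x = z x" using phix by (simp add: t_def)
  have xb: "x \<in> ball x0 R"
  proof -
    have "dist x0 x \<noteq> R" using phix by (auto simp: \<phi>_def dist_norm norm_minus_commute dot_square_norm)
    then show ?thesis using x(1) by auto
  qed
  have nx: "1 \<le> norm x" using ball(1)[OF x(1)] R by linarith
  show False
  proof (cases "u x \<le> v x")
    case True
    show False
      by (rule no_bump_touching[OF xb ne[OF x(1)] t _ _ True large[OF x(1) lower(1)[OF nx]]])
        (use le eq True in \<open>auto simp: \<phi>_def z_def\<close>)
  next
    case False
    show False
      by (rule subcritical_ground_state.no_bump_touching[OF swap xb ne[OF x(1)] t])
        (use le eq False large[OF x(1) lower(2)[OF nx]] in \<open>auto simp: \<phi>_def z_def add.commute\<close>)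
  qed
qed

end

theorem theorem1p7:
  fixes a s m N :: real
  assumes N_def: "N = real CARD('n::finite)"
    and "N > 2"
    and "s + m > 0"
    and "a > -2" and "s \<ge> 0" and "m \<ge> 0"
    and "s + m + 1 < min ((N + 2) / (N - 2)) ((N + 2 + 2 * a) / (N - 2))"
  shows "\<not> (\<exists>u v :: real^'n \<Rightarrow> real. ground_state a s m u v)"
proof
  assume "\<exists>u v :: real^'n \<Rightarrow> real. ground_state a s m u v"
  then obtain u v :: "real^'n \<Rightarrow> real" where uv: "ground_state a s m u v" by blast
  have dim: "real DIM(real^'n) = N" by (simp add: N_def)
  have "s + m + 1 < (N + 2 + 2 * a) / (N - 2)" using assms by simp
  then have "(s + m + 1) * (N - 2) < N + 2 + 2 * a"
    using \<open>N > 2\<close> by (simp add: pos_less_divide_eq)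
  then have "subcritical_ground_state u v a s m"
    using assms uv by unfold_locales (auto simp: dim)
  then show False by (rule subcritical_ground_state.no_ground_state)
qed

end
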